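(* Let $\Omega$, $\mathcal T_h$, $\mathcal N_h$, $Q_h$, $\boldsymbol U_h$, $i_{Q_h}$, $(\cdot,\cdot)_h$, $\gamma>0$, $\alpha\ge0$ be as in the context, and let $\boldsymbol u_0\in\boldsymbol H^1(\Omega)$ with $|\boldsymbol u_0|=1$ a.e. in $\Omega$ and $\boldsymbol u_{0h}\in\boldsymbol U_h$ with $|\boldsymbol u_{0h}(\boldsymbol a)|=1$ for all $\boldsymbol a\in\mathcal N_h$ and $\|\nabla\boldsymbol u_{0h}\|\le\|\nabla\boldsymbol u_0\|$. There exists $T_h>0$, depending possibly on $h$, such that there is a unique pair $(\boldsymbol u_h,q_h)\in C^\infty([0,T_h);\boldsymbol U_h)\times C^\infty([0,T_h);Q_h)$ with $\boldsymbol u_h(0)=\boldsymbol u_{0h}$ satisfying, for all $t\in[0,T_h)$ and all $(\bar{\boldsymbol u}_h,\bar q_h)\in\boldsymbol U_h\times Q_h$, $$(\partial_t\boldsymbol u_h,\bar{\boldsymbol u}_h)_h+\gamma(\nabla\boldsymbol u_h,\nabla\bar{\boldsymbol u}_h)+\gamma(q_h,i_{Q_h}(\boldsymbol u_h\cdot\bar{\boldsymbol u}_h))+\alpha(\boldsymbol u_h\times\partial_t\boldsymbol u_h,\bar{\boldsymbol u}_h)_h=0,$$ $$(i_{Q_h}(\boldsymbol u_h\cdot\boldsymbol u_h),\bar q_h)=(1,\bar q_h).$$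
   Context: $M\in\{2,3\}$; $\Omega\subset\mathbb R^M$ is a bounded domain with polygonal/polyhedral Lipschitz boundary; $\{\mathcal T_h\}_{h>0}$ is a shape-regular, quasi-uniform family of conforming triangulations of $\overline\Omega$ into triangles ($M=2$) or tetrahedra ($M=3$), $h=\max_{K\in\mathcal T_h}\operatorname{diam}K$; $\mathcal N_h$ is the set of all nodes (vertices) of $\mathcal T_h$. $X_h=\{v_h\in C^0(\overline\Omega): v_h|_K \text{ is a polynomial of degree}\le 1\ \forall K\in\mathcal T_h\}$ with nodal (Lagrange) basis $\{\varphi_{\boldsymbol a}\}_{\boldsymbol a\in\mathcal N_h}$; $Q_h=X_h$, $\boldsymbol U_h=(X_h)^M$. $i_{Q_h}:C^0(\overline\Omega)\to Q_h$ is nodal interpolation, $i_{Q_h}(f)=\sum_{\boldsymbol a}f(\boldsymbol a)\varphi_{\boldsymbol a}$. $(\cdot,\cdot)$ is the $L^2(\Omega)$ inner product and $\|\cdot\|$ its norm (for scalars, vectors, matrices). The lumped product is $(\boldsymbol v,\boldsymbol w)_h=\int_\Omega i_{Q_h}(\boldsymbol v\cdot\boldsymbol w)=\sum_{\boldsymbol a\in\mathcal N_h}\boldsymbol v(\boldsymbol a)\cdot\boldsymbol w(\boldsymbol a)\int_\Omega\varphi_{\boldsymbol a}$. $\gamma>0$ and $\alpha\ge0$ are real constants; if $M=2$ then $\alpha=0$ (the cross-product term is absent). *)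

theory Defs
  imports "HOL-Analysis.Analysis"
begin

section \<open>The domain\<close>

text \<open>Near each boundary point, \<open>\<Omega>\<close> is the strict epigraph, in some direction \<open>e\<close>, of a Lipschitz
  function \<open>g\<close> of the coordinates orthogonal to \<open>e\<close>.\<close>

definition lipschitz_boundary :: "(real^'n) set \<Rightarrow> bool" where
  "lipschitz_boundary \<Omega> \<longleftrightarrow>
     (\<forall>x\<in>frontier \<Omega>. \<exists>V e (g :: real^'n \<Rightarrow> real) L. open V \<and> x \<in> V \<and> norm e = 1 \<and>
        L-lipschitz_on {y. y \<bullet> e = 0} g \<and>
        \<Omega> \<inter> V = {y \<in> V. g (y - (y \<bullet> e) *\<^sub>R e) < y \<bullet> e})"

definition polyhedral_boundary :: "(real^'n) set \<Rightarrow> bool" where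
  "polyhedral_boundary \<Omega> \<longleftrightarrow>
     (\<exists>F. finite F \<and> (\<forall>P\<in>F. polytope P \<and> aff_dim P = int CARD('n) - 1) \<and> frontier \<Omega> = \<Union>F)"

definition polyhedral_lipschitz_domain :: "(real^'n) set \<Rightarrow> bool" where
  "polyhedral_lipschitz_domain \<Omega> \<longleftrightarrow>
     open \<Omega> \<and> connected \<Omega> \<and> \<Omega> \<noteq> {} \<and> bounded \<Omega> \<and> polyhedral_boundary \<Omega> \<and> lipschitz_boundary \<Omega>"


section \<open>Triangulations\<close>

definition conforming_triangulation :: "(real^'n) set \<Rightarrow> (real^'n) set set \<Rightarrow> bool" where
  "conforming_triangulation \<Omega> \<T> \<longleftrightarrow>
     triangulation \<T> \<and> (\<forall>K\<in>\<T>. int CARD('n) simplex K) \<and> \<Union>\<T> = closure \<Omega>"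

definition inball_diameter :: "(real^'n) set \<Rightarrow> real" where
  "inball_diameter K = Sup {2 * r | r. 0 \<le> r \<and> (\<exists>x. cball x r \<subseteq> K)}"

text \<open>The family is indexed by its mesh sizes, which range over some set \<open>H\<close> of positive reals.\<close>

definition mesh_family :: "(real^'n) set \<Rightarrow> real set \<Rightarrow> (real \<Rightarrow> (real^'n) set set) \<Rightarrow> bool" where
  "mesh_family \<Omega> H \<T> \<longleftrightarrow>
     H \<subseteq> {0<..} \<and>
     (\<forall>h\<in>H. conforming_triangulation \<Omega> (\<T> h) \<and> h = Max (diameter ` \<T> h))"

definition shape_regular :: "real set \<Rightarrow> (real \<Rightarrow> (real^'n) set set) \<Rightarrow> bool" where
  "shape_regular H \<T> \<longleftrightarrow> (\<exists>\<sigma>>0. \<forall>h\<in>H. \<forall>K\<in>\<T> h. diameter K \<le> \<sigma> * inball_diameter K)"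

definition quasi_uniform :: "real set \<Rightarrow> (real \<Rightarrow> (real^'n) set set) \<Rightarrow> bool" where
  "quasi_uniform H \<T> \<longleftrightarrow> (\<exists>c>0. \<forall>h\<in>H. \<forall>K\<in>\<T> h. c * h \<le> diameter K)"

definition nodes :: "(real^'n) set set \<Rightarrow> (real^'n) set" where
  "nodes \<T> = (\<Union>K\<in>\<T>. {a. a extreme_point_of K})"


section \<open>Finite element spaces\<close>

text \<open>Functions on \<open>closure \<Omega>\<close> are represented by total functions that vanish outside
  \<open>closure \<Omega>\<close>, so that equality of functions is equality on \<open>closure \<Omega>\<close>.\<close>

definition X_space :: "(real^'n) set \<Rightarrow> (real^'n) set set \<Rightarrow> (real^'n \<Rightarrow> real) set" where
  "X_space \<Omega> \<T> =
     {v. continuous_on (closure \<Omega>) v \<and> (\<forall>K\<in>\<T>. \<exists>b c. \<forall>x\<in>K. v x = b \<bullet> x + c) \<and>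
         (\<forall>x. x \<notin> closure \<Omega> \<longrightarrow> v x = 0)}"

abbreviation Q_space :: "(real^'n) set \<Rightarrow> (real^'n) set set \<Rightarrow> (real^'n \<Rightarrow> real) set" where
  "Q_space \<equiv> X_space"

definition U_space :: "(real^'n) set \<Rightarrow> (real^'n) set set \<Rightarrow> (real^'n \<Rightarrow> real^'n) set" where
  "U_space \<Omega> \<T> = {v. \<forall>i. (\<lambda>x. v x $ i) \<in> X_space \<Omega> \<T>}"

definition nodal_basis :: "(real^'n) set \<Rightarrow> (real^'n) set set \<Rightarrow> real^'n \<Rightarrow> real^'n \<Rightarrow> real" where
  "nodal_basis \<Omega> \<T> a =
     (THE v. v \<in> X_space \<Omega> \<T> \<and> (\<forall>b\<in>nodes \<T>. v b = (if b = a then 1 else 0)))"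

definition nodal_interp ::
    "(real^'n) set \<Rightarrow> (real^'n) set set \<Rightarrow> (real^'n \<Rightarrow> real) \<Rightarrow> real^'n \<Rightarrow> real" where
  "nodal_interp \<Omega> \<T> f x = (\<Sum>a\<in>nodes \<T>. f a * nodal_basis \<Omega> \<T> a x)"


section \<open>Inner products\<close>

text \<open>For matrix-valued functions the inner product of \<open>real^'n^'n\<close> is the Frobenius product.\<close>

definition L2_inner :: "(real^'n) set \<Rightarrow> (real^'n \<Rightarrow> 'b::real_inner) \<Rightarrow> (real^'n \<Rightarrow> 'b) \<Rightarrow> real" where
  "L2_inner \<Omega> f g = (\<integral>x. f x \<bullet> g x \<partial>lebesgue_on \<Omega>)"

definition L2_norm :: "(real^'n) set \<Rightarrow> (real^'n \<Rightarrow> 'b::real_inner) \<Rightarrow> real" where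
  "L2_norm \<Omega> f = sqrt (L2_inner \<Omega> f f)"

definition lumped_inner ::
    "(real^'n) set \<Rightarrow> (real^'n) set set \<Rightarrow> (real^'n \<Rightarrow> real^'n) \<Rightarrow> (real^'n \<Rightarrow> real^'n) \<Rightarrow> real" where
  "lumped_inner \<Omega> \<T> v w = (\<integral>x. nodal_interp \<Omega> \<T> (\<lambda>y. v y \<bullet> w y) x \<partial>lebesgue_on \<Omega>)"

text \<open>The gradient of a finite element function: the matrix with entries
  \<open>\<partial>\<^sub>j v\<^sub>i\<close> in row \<open>i\<close> and column \<open>j\<close>. It is constant on the interior of each element; its values on
  the element interfaces, a null set, are irrelevant.\<close>

definition grad :: "(real^'n \<Rightarrow> real^'n) \<Rightarrow> real^'n \<Rightarrow> real^'n^'n" where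
  "grad v x = jacobian v (at x)"


section \<open>The Sobolev space H1\<close>

text \<open>In the following definition \<open>D [i\<^sub>k, \<dots>, i\<^sub>1]\<close> is the iterated partial derivative
  \<open>\<partial>\<^sub>i\<^sub>k \<dots> \<partial>\<^sub>i\<^sub>1 f\<close>.\<close>

definition smooth :: "(real^'n \<Rightarrow> real) \<Rightarrow> bool" where
  "smooth f \<longleftrightarrow>
     (\<exists>D :: 'n list \<Rightarrow> real^'n \<Rightarrow> real. D [] = f \<and>
        (\<forall>is x. (D is has_derivative (\<lambda>v. \<Sum>i\<in>UNIV. v $ i * D (i # is) x)) (at x)))"

definition test_function :: "(real^'n) set \<Rightarrow> (real^'n \<Rightarrow> real) \<Rightarrow> bool" where
  "test_function \<Omega> \<phi> \<longleftrightarrow>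
     smooth \<phi> \<and> compact (closure {x. \<phi> x \<noteq> 0}) \<and> closure {x. \<phi> x \<noteq> 0} \<subseteq> \<Omega>"

definition square_integrable :: "(real^'n) set \<Rightarrow> (real^'n \<Rightarrow> 'b::euclidean_space) \<Rightarrow> bool" where
  "square_integrable \<Omega> f \<longleftrightarrow>
     f \<in> borel_measurable (lebesgue_on \<Omega>) \<and> integrable (lebesgue_on \<Omega>) (\<lambda>x. (norm (f x))\<^sup>2)"

definition has_weak_grad ::
    "(real^'n) set \<Rightarrow> (real^'n \<Rightarrow> real^'n) \<Rightarrow> (real^'n \<Rightarrow> real^'n^'n) \<Rightarrow> bool" where
  "has_weak_grad \<Omega> u G \<longleftrightarrow>
     (\<forall>\<phi> i j. test_function \<Omega> \<phi> \<longrightarrow>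
        (\<integral>x. u x $ i * frechet_derivative \<phi> (at x) (axis j 1) \<partial>lebesgue_on \<Omega>) =
        - (\<integral>x. G x $ i $ j * \<phi> x \<partial>lebesgue_on \<Omega>))"

definition H1 :: "(real^'n) set \<Rightarrow> (real^'n \<Rightarrow> real^'n) set" where
  "H1 \<Omega> = {u. square_integrable \<Omega> u \<and> (\<exists>G. square_integrable \<Omega> G \<and> has_weak_grad \<Omega> u G)}"

text \<open>The square-integrable weak gradient is unique up to a null set, so \<open>L2_norm \<Omega> (weak_grad \<Omega> u)\<close>
  does not depend on the choice.\<close>

definition weak_grad :: "(real^'n) set \<Rightarrow> (real^'n \<Rightarrow> real^'n) \<Rightarrow> real^'n \<Rightarrow> real^'n^'n" where
  "weak_grad \<Omega> u = (SOME G. square_integrable \<Omega> G \<and> has_weak_grad \<Omega> u G)"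


section \<open>Time-dependent finite element functions\<close>

text \<open>\<open>u\<close> is an infinitely differentiable map from \<open>[0,\<tau>)\<close> into the finite-dimensional
  space \<open>V\<close> of functions on \<open>closure \<Omega>\<close>: \<open>D k\<close> is its \<open>k\<close>-th derivative, and difference quotients
  converge in the maximum norm over \<open>closure \<Omega>\<close>. At \<open>t = 0\<close> derivatives are one-sided.\<close>

definition smooth_curve ::
    "(real^'n) set \<Rightarrow> (real^'n \<Rightarrow> 'b::real_normed_vector) set \<Rightarrow> real \<Rightarrow>
     (real \<Rightarrow> real^'n \<Rightarrow> 'b) \<Rightarrow> bool" where
  "smooth_curve \<Omega> V \<tau> u \<longleftrightarrow>
     (\<exists>D. D 0 = u \<and>
        (\<forall>k. \<forall>t\<in>{0..<\<tau>}. D k t \<in> V \<and>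
           uniform_limit (closure \<Omega>) (\<lambda>s x. (D k s x - D k t x) /\<^sub>R (s - t))
             (D (Suc k) t) (at t within {0..<\<tau>})))"

definition time_deriv ::
    "real \<Rightarrow> (real \<Rightarrow> real^'n \<Rightarrow> 'b::real_normed_vector) \<Rightarrow> real \<Rightarrow> real^'n \<Rightarrow> 'b" where
  "time_deriv \<tau> u t x = vector_derivative (\<lambda>s. u s x) (at t within {0..<\<tau>})"


section \<open>The semi-discrete problem\<close>

definition admissible_data ::
    "(real^'n) set \<Rightarrow> (real^'n) set set \<Rightarrow> (real^'n \<Rightarrow> real^'n) \<Rightarrow> (real^'n \<Rightarrow> real^'n) \<Rightarrow> bool" where
  "admissible_data \<Omega> \<T> u0 u0h \<longleftrightarrow>
     u0 \<in> H1 \<Omega> \<and> (AE x in lebesgue_on \<Omega>. norm (u0 x) = 1) \<and>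
     u0h \<in> U_space \<Omega> \<T> \<and> (\<forall>a\<in>nodes \<T>. norm (u0h a) = 1) \<and>
     L2_norm \<Omega> (grad u0h) \<le> L2_norm \<Omega> (weak_grad \<Omega> u0)"

text \<open>The parameter \<open>cross\<close> is the vector product. In two dimensions, where the vector product term
  is absent, the definition is used with \<open>\<alpha> = 0\<close> and the zero map for \<open>cross\<close>.\<close>

definition semidiscrete_solution ::
    "(real^'n \<Rightarrow> real^'n \<Rightarrow> real^'n) \<Rightarrow> (real^'n) set \<Rightarrow> (real^'n) set set \<Rightarrow> real \<Rightarrow> real \<Rightarrow>
     (real^'n \<Rightarrow> real^'n) \<Rightarrow> real \<Rightarrow> (real \<Rightarrow> real^'n \<Rightarrow> real^'n) \<Rightarrow> (real \<Rightarrow> real^'n \<Rightarrow> real) \<Rightarrow> bool" where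
  "semidiscrete_solution cross \<Omega> \<T> \<gamma> \<alpha> u0h \<tau> u q \<longleftrightarrow>
     smooth_curve \<Omega> (U_space \<Omega> \<T>) \<tau> u \<and> smooth_curve \<Omega> (Q_space \<Omega> \<T>) \<tau> q \<and> u 0 = u0h \<and>
     (\<forall>t\<in>{0..<\<tau>}. \<forall>w\<in>U_space \<Omega> \<T>. \<forall>r\<in>Q_space \<Omega> \<T>.
        lumped_inner \<Omega> \<T> (time_deriv \<tau> u t) w
        + \<gamma> * L2_inner \<Omega> (grad (u t)) (grad w)
        + \<gamma> * L2_inner \<Omega> (q t) (nodal_interp \<Omega> \<T> (\<lambda>x. u t x \<bullet> w x))
        + \<alpha> * lumped_inner \<Omega> \<T> (\<lambda>x. cross (u t x) (time_deriv \<tau> u t x)) w = 0 \<and>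
        L2_inner \<Omega> (nodal_interp \<Omega> \<T> (\<lambda>x. u t x \<bullet> u t x)) r = L2_inner \<Omega> (\<lambda>x. 1) r)"

end

(* Testing with the nodal basis turns the scheme into a system for the nodal values u_a on the unit
   sphere: m_a (u_a' + alpha u_a x u_a') + gamma ((A u)_a + (M q)_a u_a) = 0, with lumped masses m_a > 0,
   stiffness matrix A and mass matrix M. Since |u_a| = 1, the vectors u_a' and u_a are orthogonal, so
   the inner product with u_a gives (M q)_a = - (A u)_a . u_a, which determines q because M is positive
   definite. On the tangent plane I + alpha u_a x has the inverse (I - alpha u_a x) / (1 + alpha^2), which
   leaves an ODE u' = F(u). Replacing the term - (A u)_a there by - |u_a|^2 (A u)_a, which is the same on the sphere,
   makes F a polynomial vector field with F(u)_a . u_a = 0 for all u, so |u_a| is conserved exactly,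
   and all time derivatives of a solution are polynomials in its components, hence differentiable again. *)

theory Submission
  imports Defs "HOL-Probability.Discrete_Topology"
begin

section \<open>Ordinary differential equations\<close>

text \<open>The scheme is a differential-algebraic system: no equation contains a time derivative of
  \<open>q\<close>. Orthogonality of u_a and u_a' is not one of the equations either; it comes from
  differentiating the constraint in time, so uniqueness first has to turn an arbitrary competing
  pair into a solution of the nodal ODE. The constraint also gives the a priori bound |u_a| = 1,
  under which a vector field that is Lipschitz only on bounded sets still yields uniqueness on the
  whole interval. For existence the order is reversed: the flow is built with no constraint imposed,
  so the field has to be tangential off the sphere as well. The lumped product decouples the nodes
  in the time derivative, but the multiplier enters through the exact L2 product, so
  \<open>q\<close> is recovered through the inverse of a mass matrix coupling the nodes. That
  inverse is constant in time, hence \<open>q\<close> is again polynomial in the components of u.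
  Finally, nodal derivatives become uniform ones on the closure of the domain because the basis
  functions take values between 0 and 1.\<close>

text \<open>Banach's fixed point theorem for the integral operator on curves with values in the
  closed ball, where the Lipschitz bound is available.\<close>

lemma picard_lindelof_local:
  fixes F :: "'a::banach \<Rightarrow> 'a"
  assumes r: "r > 0" and lip: "L-lipschitz_on (cball x0 r) F"
  obtains \<tau> x where "\<tau> > 0" "x 0 = x0"
    "\<And>t. t \<in> {0..\<tau>} \<Longrightarrow> x t \<in> cball x0 r"
    "\<And>t. t \<in> {0..\<tau>} \<Longrightarrow> (x has_vector_derivative F (x t)) (at t within {0..\<tau>})"
proof -
  have L: "L \<ge> 0" using lip by (rule lipschitz_on_nonneg)
  define B where "B = norm (F x0) + L * r"
  have B: "norm (F z) \<le> B" if "z \<in> cball x0 r" for z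
  proof -
    have "dist (F z) (F x0) \<le> L * dist z x0"
      using lip that r by (intro lipschitz_onD) auto
    also have "\<dots> \<le> L * r" using L that by (intro mult_left_mono) (auto simp: dist_commute)
    finally show ?thesis unfolding B_def dist_norm using norm_triangle_sub[of "F z" "F x0"] by simp
  qed
  have B0: "B \<ge> 0" unfolding B_def using L r by auto
  \<comment> \<open>The first bound keeps the image curves in the ball, the second gives the
    contraction factor 1/2. Adding 1 avoids division by zero.\<close>
  define \<tau> where "\<tau> = min (r / (B + 1)) (1 / (2 * (L + 1)))"
  have \<tau>: "\<tau> > 0" unfolding \<tau>_def using r B0 L by auto
  have \<tau>B: "\<tau> * B \<le> r"
  proof -
    have "\<tau> * B \<le> r / (B + 1) * (B + 1)" using B0 \<tau> unfolding \<tau>_def by (intro mult_mono) auto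
    then show ?thesis using B0 by simp
  qed
  have \<tau>L: "L * \<tau> \<le> 1 / 2"
  proof -
    have "L * \<tau> \<le> (L + 1) * (1 / (2 * (L + 1)))" using L \<tau> unfolding \<tau>_def by (intro mult_mono) auto
    also have "\<dots> = 1 / 2" using L by (simp add: field_simps)
    finally show ?thesis .
  qed
  have contF: "continuous_on (cball x0 r) F" using lip by (rule lipschitz_on_continuous_on)
  \<comment> \<open>Curves live on the whole line, where bounded continuous functions form a
    complete space; clamping time confines every integral to [0,\<tau>].\<close>
  define c where "c t = max 0 (min \<tau> t)" for t :: real
  have c: "c t \<in> {0..\<tau>}" for t unfolding c_def using \<tau> by auto
  have cid: "c t = t" if "t \<in> {0..\<tau>}" for t using that unfolding c_def by auto
  have contc: "continuous_on UNIV c" unfolding c_def by (intro continuous_intros)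
  define S where "S = {y :: real \<Rightarrow>\<^sub>C 'a. \<forall>t. y t \<in> cball x0 r}"
  define G where "G y t = x0 + integral {0..c t} (\<lambda>s. F (apply_bcontfun y s))" for y :: "real \<Rightarrow>\<^sub>C 'a" and t
  have contFy: "continuous_on A (\<lambda>s. F (apply_bcontfun y s))" if "y \<in> S" for y A
    using that by (intro continuous_on_compose2[OF contF]) (auto simp: S_def)
  have intFy: "(\<lambda>s. F (apply_bcontfun y s)) integrable_on {a..b}" if "y \<in> S" for y a b
    using contFy[OF that] by (rule integrable_continuous_real)
  have Gball: "G y t \<in> cball x0 r" if "y \<in> S" for y t
  proof -
    have "norm (integral {0..c t} (\<lambda>s. F (apply_bcontfun y s))) \<le> B * (c t - 0)"
      using c[of t] that by (intro integral_bound contFy that B) (auto simp: S_def)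
    also have "\<dots> \<le> B * \<tau>" using c[of t] B0 by (intro mult_left_mono) auto
    finally show ?thesis using \<tau>B unfolding G_def by (simp add: dist_norm mult.commute)
  qed
  have Gbc: "G y \<in> bcontfun" if "y \<in> S" for y
  proof -
    have "continuous_on UNIV (\<lambda>t. integral {0..c t} (\<lambda>s. F (apply_bcontfun y s)))"
      by (rule continuous_on_compose2[OF indefinite_integral_continuous_1[OF intFy[OF that], of 0 \<tau>] contc])
        (use c in auto)
    then have "continuous_on UNIV (G y)" unfolding G_def by (intro continuous_intros)
    moreover have "bounded (range (G y))"
      using Gball[OF that] by (intro bounded_subset[OF bounded_cball[of x0 r]]) auto
    ultimately show ?thesis by (simp add: bcontfun_def)
  qed
  define \<Phi> where "\<Phi> y = Bcontfun (G y)" for y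
  have \<Phi>: "apply_bcontfun (\<Phi> y) = G y" if "y \<in> S" for y
    unfolding \<Phi>_def using Gbc[OF that] by (rule Bcontfun_inverse)
  have "closed S"
  proof -
    have "S = PiC UNIV (\<lambda>_. cball x0 r)" by (simp add: S_def set_eq_iff mem_PiC_iff Pi_iff)
    then show ?thesis using closed_PiC[of UNIV "\<lambda>_. cball x0 r"] by simp
  qed
  then have "complete S" by (simp add: complete_eq_closed)
  moreover have "const_bcontfun x0 \<in> S" using r by (auto simp: S_def const_bcontfun.rep_eq)
  then have "S \<noteq> {}" by blast
  moreover have "\<Phi> ` S \<subseteq> S" using Gball \<Phi> by (auto simp: S_def)
  moreover have "dist (\<Phi> y) (\<Phi> z) \<le> 1/2 * dist y z" if "y \<in> S" "z \<in> S" for y z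
  proof (rule dist_bound)
    fix t
    have "norm (integral {0..c t} (\<lambda>s. F (apply_bcontfun y s) - F (apply_bcontfun z s))) \<le> L * dist y z * (c t - 0)"
    proof (intro integral_bound)
      fix s
      have "dist (F (y s)) (F (z s)) \<le> L * dist (y s) (z s)"
        using lip that by (intro lipschitz_onD) (auto simp: S_def)
      also have "\<dots> \<le> L * dist y z" by (intro mult_left_mono dist_bounded L)
      finally show "norm (F (y s) - F (z s)) \<le> L * dist y z" by (simp add: dist_norm)
    qed (use c[of t] that contFy in \<open>auto intro!: continuous_intros\<close>)
    also have "\<dots> \<le> L * dist y z * \<tau>" using c[of t] L by (intro mult_left_mono) auto
    also have "\<dots> = L * \<tau> * dist y z" by simp
    also have "\<dots> \<le> 1/2 * dist y z" using \<tau>L by (intro mult_right_mono) auto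
    finally show "dist (\<Phi> y t) (\<Phi> z t) \<le> 1/2 * dist y z"
      using that by (simp add: \<Phi> G_def dist_norm integral_diff[OF intFy intFy])
  qed
  ultimately have "\<exists>!y\<in>S. \<Phi> y = y" by (intro Banach_fix[of S "1/2"]) auto
  then obtain y where y: "y \<in> S" "\<Phi> y = y" by blast
  have eq: "y t = x0 + integral {0..t} (\<lambda>s. F (apply_bcontfun y s))" if "t \<in> {0..\<tau>}" for t
    using \<Phi>[OF y(1)] y(2) cid[OF that] by (metis G_def)
  show thesis
  proof (rule that[OF \<tau>, of "apply_bcontfun y"])
    show "y 0 = x0" using eq[of 0] \<tau> by simp
    show "y t \<in> cball x0 r" for t using y(1) by (auto simp: S_def)
    fix t assume t: "t \<in> {0..\<tau>}"
    have "((\<lambda>t. x0 + integral {0..t} (\<lambda>s. F (apply_bcontfun y s))) has_vector_derivative F (y t)) (at t within {0..\<tau>})"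
      using integral_has_vector_derivative[OF contFy[OF y(1)] t] by (auto intro!: derivative_eq_intros)
    then show "(apply_bcontfun y has_vector_derivative F (y t)) (at t within {0..\<tau>})"
      using eq t by (auto intro: has_vector_derivative_transform)
  qed
qed

text \<open>Allows the bounded functions on a discrete space to serve as the state space of a system
  of ODEs.\<close>

instance bcontfun :: (metric_space, banach) banach ..

text \<open>The unknowns are indexed by a finite set rather than a type, so families of values are
  not elements of a Banach space type. \<open>up\<close> extends a family by zero off
  \<open>I\<close> and views it as a function on the discrete space over the index type, where
  continuity is automatic; the sup norm then allows the previous lemma to be applied.\<close>

lemma picard_lindelof_system:
  fixes F :: "('i \<Rightarrow> 'b::banach) \<Rightarrow> 'i \<Rightarrow> 'b"
  assumes I: "finite I"
    and lip: "\<And>R i. i \<in> I \<Longrightarrow> \<exists>L. \<forall>u v. (\<forall>j\<in>I. norm (u j) \<le> R \<and> norm (v j) \<le> R) \<longrightarrow>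
       norm (F u i - F v i) \<le> L * (\<Sum>j\<in>I. norm (u j - v j))"
  obtains \<tau> x where "\<tau> > 0" "\<And>i. i \<in> I \<Longrightarrow> x 0 i = x0 i"
    "\<And>t i. t \<in> {0..\<tau>} \<Longrightarrow> i \<in> I \<Longrightarrow>
       ((\<lambda>s. x s i) has_vector_derivative F (x t) i) (at t within {0..\<tau>})"
proof -
  define up where "up w k = (if of_discrete k \<in> I then w (of_discrete k) else 0)"
    for w :: "'i \<Rightarrow> 'b" and k :: "'i discrete"
  have "finite (range (up w))" for w
    by (rule finite_subset[of _ "insert 0 (w ` I)"]) (auto simp: up_def I)
  moreover have "continuous_on UNIV (up w)" for w
    unfolding continuous_on_open_vimage[OF open_UNIV] by (intro allI impI open_discrete)
  ultimately have "up w \<in> bcontfun" for w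
    unfolding bcontfun_def by (blast intro: finite_imp_bounded)
  then have up: "apply_bcontfun (Bcontfun (up w)) = up w" for w
    by (rule Bcontfun_inverse)
  define dn where "dn z i = apply_bcontfun z (discrete i)" for z :: "'i discrete \<Rightarrow>\<^sub>C 'b" and i
  define G where "G z = Bcontfun (up (F (dn z)))" for z
  define z0 where "z0 = Bcontfun (up x0)"
  \<comment> \<open>Bounds every component of every element of the unit ball around
    \<open>z0\<close>.\<close>
  define R where "R = norm z0 + 1"
  have nb: "norm (apply_bcontfun z k) \<le> norm z" for z :: "'i discrete \<Rightarrow>\<^sub>C 'b" and k
    by (rule norm_bounded)
  obtain L where L: "\<And>i u v. i \<in> I \<Longrightarrow> (\<forall>j\<in>I. norm (u j) \<le> R \<and> norm (v j) \<le> R) \<Longrightarrow>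
       norm (F u i - F v i) \<le> L i * (\<Sum>j\<in>I. norm (u j - v j))"
    using lip[where R=R] by metis
  \<comment> \<open>The sum dominates each single \<open>L i\<close>; the cardinality arises because
    each of the distances summed over \<open>I\<close> is at most the sup distance.\<close>
  define K where "K = (\<Sum>i\<in>I. \<bar>L i\<bar>) * card I"
  have K: "K \<ge> 0" by (auto simp: K_def sum_nonneg)
  have lipG: "K-lipschitz_on (cball z0 1) G"
  proof (rule lipschitz_onI[OF _ K])
    fix z y assume zy: "z \<in> cball z0 1" "y \<in> cball z0 1"
    have nR: "norm (apply_bcontfun w k) \<le> R" if "w \<in> cball z0 1" for w k
      using nb[of w k] that norm_triangle_sub[of w z0] unfolding R_def by (simp add: dist_norm norm_minus_commute)
    show "dist (G z) (G y) \<le> K * dist z y"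
    proof (rule dist_bound)
      fix k
      show "dist (G z k) (G y k) \<le> K * dist z y"
      proof (cases "of_discrete k \<in> I")
        case True
        have "norm (F (dn z) (of_discrete k) - F (dn y) (of_discrete k)) \<le> L (of_discrete k) * (\<Sum>j\<in>I. norm (dn z j - dn y j))"
          using nR zy by (intro L True) (auto simp: dn_def)
        also have "\<dots> \<le> (\<Sum>i\<in>I. \<bar>L i\<bar>) * (\<Sum>j\<in>I. dist z y)"
        proof (intro mult_mono sum_mono)
          show "L (of_discrete k) \<le> (\<Sum>i\<in>I. \<bar>L i\<bar>)"
            using member_le_sum[OF True, of "\<lambda>i. \<bar>L i\<bar>"] I by simp
        qed (use dist_bounded[of z _ y] in \<open>auto simp: dn_def dist_norm sum_nonneg\<close>)
        finally show ?thesis using True by (simp add: G_def up up_def dist_norm K_def)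
      qed (use K in \<open>simp add: G_def up up_def\<close>)
    qed
  qed
  show thesis
  proof (rule picard_lindelof_local[OF zero_less_one lipG])
    fix \<tau> x assume x: "\<tau> > 0" "x 0 = z0"
      "\<And>t. t \<in> {0..\<tau>} \<Longrightarrow> (x has_vector_derivative G (x t)) (at t within {0..\<tau>})"
    show thesis
    proof (rule that[OF x(1), of "\<lambda>t. dn (x t)"])
      fix i assume i: "i \<in> I"
      show "dn (x 0) i = x0 i" using i by (simp add: dn_def x(2) z0_def up up_def discrete_inverse)
      fix t assume "t \<in> {0..\<tau>}"
      have "bounded_linear (\<lambda>z :: 'i discrete \<Rightarrow>\<^sub>C 'b. z (discrete i))"
        by (rule bounded_linear_intro[where K=1]) (auto simp: nb)
      from bounded_linear.has_vector_derivative[OF this x(3)[OF \<open>t \<in> _\<close>]]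
      show "((\<lambda>s. dn (x s) i) has_vector_derivative F (dn (x t)) i) (at t within {0..\<tau>})"
        using i by (simp add: dn_def[abs_def] G_def up up_def discrete_inverse)
    qed
  qed
qed

text \<open>The squared distance \<open>e\<close> satisfies e' \<le> C e, so e(s) exp(-C s) does not
  increase from its initial value 0. The Lipschitz bound is asked for only along the two curves,
  which is where solutions of the scheme are known to be bounded.\<close>

lemma gronwall_unique_system:
  fixes F :: "('i \<Rightarrow> 'b::real_inner) \<Rightarrow> 'i \<Rightarrow> 'b"
  assumes I: "finite I"
    and lip: "\<And>t i. t \<in> {0..<\<tau>} \<Longrightarrow> i \<in> I \<Longrightarrow>
       norm (F (x t) i - F (y t) i) \<le> L * (\<Sum>j\<in>I. norm (x t j - y t j))"
    and init: "\<And>i. i \<in> I \<Longrightarrow> x 0 i = y 0 i"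
    and dx: "\<And>t i. t \<in> {0..<\<tau>} \<Longrightarrow> i \<in> I \<Longrightarrow>
       ((\<lambda>s. x s i) has_vector_derivative F (x t) i) (at t within {0..<\<tau>})"
    and dy: "\<And>t i. t \<in> {0..<\<tau>} \<Longrightarrow> i \<in> I \<Longrightarrow>
       ((\<lambda>s. y s i) has_vector_derivative F (y t) i) (at t within {0..<\<tau>})"
    and t: "t \<in> {0..<\<tau>}" and i: "i \<in> I"
  shows "x t i = y t i"
proof -
  define d where "d s j = x s j - y s j" for s j
  define f where "f s j = F (x s) j - F (y s) j" for s j
  define e where "e s = (\<Sum>j\<in>I. d s j \<bullet> d s j)" for s
  \<comment> \<open>The factor 2 comes from differentiating a square, the cardinality from the
    Cauchy-Schwarz bound of a squared sum by the sum of squares.\<close>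
  define C where "C = 2 * \<bar>L\<bar> * card I"
  have e0: "e s \<ge> 0" for s unfolding e_def by (intro sum_nonneg) auto
  have dd: "((\<lambda>s. d s j) has_vector_derivative f s j) (at s within {0..<\<tau>})" if "s \<in> {0..<\<tau>}" "j \<in> I" for s j
    unfolding d_def f_def by (intro has_vector_derivative_diff dx dy that)
  have de: "(e has_real_derivative (\<Sum>j\<in>I. 2 * (d s j \<bullet> f s j))) (at s within {0..<\<tau>})" if "s \<in> {0..<\<tau>}" for s
    unfolding e_def
  proof (rule DERIV_sum)
    fix j assume "j \<in> I"
    from bounded_bilinear.has_vector_derivative[OF bounded_bilinear_inner dd[OF that this] dd[OF that this]]
    show "((\<lambda>s. d s j \<bullet> d s j) has_real_derivative 2 * (d s j \<bullet> f s j)) (at s within {0..<\<tau>})"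
      by (simp add: has_real_derivative_iff_has_vector_derivative inner_commute)
  qed
  have bd: "(\<Sum>j\<in>I. 2 * (d s j \<bullet> f s j)) \<le> C * e s" if s: "s \<in> {0..<\<tau>}" for s
  proof -
    let ?S = "\<Sum>j\<in>I. norm (d s j)"
    have "d s j \<bullet> f s j \<le> norm (d s j) * (\<bar>L\<bar> * ?S)" if "j \<in> I" for j
    proof -
      have "norm (f s j) \<le> L * ?S" using lip[OF s that] by (simp add: d_def f_def)
      also have "\<dots> \<le> \<bar>L\<bar> * ?S" by (intro mult_right_mono) (auto simp: sum_nonneg)
      finally have "norm (d s j) * norm (f s j) \<le> norm (d s j) * (\<bar>L\<bar> * ?S)" by (rule mult_left_mono) simp
      then show ?thesis using norm_cauchy_schwarz[of "d s j" "f s j"] by linarith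
    qed
    then have "(\<Sum>j\<in>I. 2 * (d s j \<bullet> f s j)) \<le> (\<Sum>j\<in>I. 2 * (norm (d s j) * (\<bar>L\<bar> * ?S)))"
      by (intro sum_mono) auto
    also have "\<dots> = 2 * \<bar>L\<bar> * ?S\<^sup>2" by (simp add: sum_distrib_left sum_distrib_right power2_eq_square mult_ac)
    also have "?S\<^sup>2 \<le> (\<Sum>j\<in>I. 1\<^sup>2) * (\<Sum>j\<in>I. (norm (d s j))\<^sup>2)"
      using Cauchy_Schwarz_ineq_sum[of "\<lambda>_. 1::real" "\<lambda>j. norm (d s j)" I] by simp
    then have "2 * \<bar>L\<bar> * ?S\<^sup>2 \<le> 2 * \<bar>L\<bar> * (card I * e s)"
      by (intro mult_left_mono) (auto simp: e_def power2_norm_eq_inner)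
    finally show ?thesis by (simp add: C_def mult_ac)
  qed
  define h where "h s = e s * exp (- C * s)" for s
  have "h t \<le> h 0"
  proof (cases "t = 0")
    case False
    then have t0: "0 < t" using t by auto
    have sub: "{0..t} \<subseteq> {0..<\<tau>}" using t by auto
    have dh: "(h has_real_derivative ((\<Sum>j\<in>I. 2 * (d s j \<bullet> f s j)) - C * e s) * exp (- C * s)) (at s within {0..<\<tau>})"
      if "s \<in> {0..<\<tau>}" for s
      unfolding h_def by (rule derivative_eq_intros de[OF that] refl | simp add: algebra_simps)+
    have nin: "((\<Sum>j\<in>I. 2 * (d s j \<bullet> f s j)) - C * e s) * exp (- C * s) \<le> 0" if "s \<in> {0..<\<tau>}" for s
      using bd[OF that] by (intro mult_nonpos_nonneg) auto
    define h' where "h' s = ((\<Sum>j\<in>I. 2 * (d s j \<bullet> f s j)) - C * e s) * exp (- C * s)" for s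
    have "(h has_derivative (*) (h' s)) (at s within {0..t})" if "0 \<le> s" "s \<le> t" for s
      using dh[of s] sub that unfolding h'_def
      by (intro has_derivative_subset[OF _ sub]) (auto simp: has_field_derivative_def)
    from mvt_simple[OF t0 this] obtain s where "s \<in> {0<..<t}" "h t - h 0 = h' s * t" by auto
    then show ?thesis using nin[of s] t t0 unfolding h'_def
      by (smt (verit) atLeastLessThan_iff greaterThanLessThan_iff mult_nonpos_nonneg)
  qed simp
  moreover have "h 0 = 0" by (simp add: h_def e_def d_def init)
  ultimately have "e t \<le> 0" by (simp add: h_def mult_le_0_iff)
  then have "e t = 0" using e0[of t] by simp
  then show ?thesis using i I by (simp add: e_def sum_nonneg_eq_0_iff d_def)
qed

section \<open>Algebraic closure of the functions that are Lipschitz on bounded sets\<close>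

text \<open>The bound \<open>B\<close> is carried along with the Lipschitz constant because the rule
  for products needs it.\<close>

definition lipschitz_on_bounded :: "'i set \<Rightarrow> (('i \<Rightarrow> 'b::real_normed_vector) \<Rightarrow> 'c::real_normed_vector) \<Rightarrow> bool" where
  "lipschitz_on_bounded I f \<longleftrightarrow> (\<forall>R. \<exists>L B. \<forall>u v. (\<forall>j\<in>I. norm (u j) \<le> R \<and> norm (v j) \<le> R) \<longrightarrow>
     norm (f u) \<le> B \<and> norm (f v) \<le> B \<and> norm (f u - f v) \<le> L * (\<Sum>j\<in>I. norm (u j - v j)))"

lemma lipschitz_on_boundedE:
  assumes "lipschitz_on_bounded I f"
  obtains L B where "\<forall>u v. (\<forall>j\<in>I. norm (u j) \<le> R \<and> norm (v j) \<le> R) \<longrightarrow>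
     norm (f u) \<le> B \<and> norm (f v) \<le> B \<and> norm (f u - f v) \<le> L * (\<Sum>j\<in>I. norm (u j - v j))"
  using assms[unfolded lipschitz_on_bounded_def, THEN spec[of _ R]] by (elim exE)

lemma lipschitz_on_bounded_proj:
  fixes i :: 'i
  assumes "finite I" "i \<in> I" shows "lipschitz_on_bounded I (\<lambda>u :: 'i \<Rightarrow> 'b::real_normed_vector. u i)"
  unfolding lipschitz_on_bounded_def
proof
  fix R
  show "\<exists>L B. \<forall>u v :: 'i \<Rightarrow> 'b. (\<forall>j\<in>I. norm (u j) \<le> R \<and> norm (v j) \<le> R) \<longrightarrow>
      norm (u i) \<le> B \<and> norm (v i) \<le> B \<and> norm (u i - v i) \<le> L * (\<Sum>j\<in>I. norm (u j - v j))"
  proof (rule exI[of _ 1], rule exI[of _ R], intro allI impI)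
    fix u v :: "'i \<Rightarrow> 'b" assume "\<forall>j\<in>I. norm (u j) \<le> R \<and> norm (v j) \<le> R"
    then show "norm (u i) \<le> R \<and> norm (v i) \<le> R \<and> norm (u i - v i) \<le> 1 * (\<Sum>j\<in>I. norm (u j - v j))"
      using member_le_sum[of i I "\<lambda>j. norm (u j - v j)"] assms by simp
  qed
qed

lemma lipschitz_on_bounded_const: "lipschitz_on_bounded I (\<lambda>u. c)"
  unfolding lipschitz_on_bounded_def by (intro allI exI[of _ 0] exI[of _ "norm c"]) auto

lemma lipschitz_on_bounded_diff:
  fixes f g :: "('i \<Rightarrow> 'b::real_normed_vector) \<Rightarrow> 'c::real_normed_vector"
  assumes "lipschitz_on_bounded I f" "lipschitz_on_bounded I g"
  shows "lipschitz_on_bounded I (\<lambda>u. f u - g u)"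
  unfolding lipschitz_on_bounded_def
proof
  fix R
  obtain L B where f: "\<forall>u v. (\<forall>j\<in>I. norm (u j) \<le> R \<and> norm (v j) \<le> R) \<longrightarrow>
     norm (f u) \<le> B \<and> norm (f v) \<le> B \<and> norm (f u - f v) \<le> L * (\<Sum>j\<in>I. norm (u j - v j))"
    by (rule lipschitz_on_boundedE[OF assms(1)])
  obtain L' B' where g: "\<forall>u v. (\<forall>j\<in>I. norm (u j) \<le> R \<and> norm (v j) \<le> R) \<longrightarrow>
     norm (g u) \<le> B' \<and> norm (g v) \<le> B' \<and> norm (g u - g v) \<le> L' * (\<Sum>j\<in>I. norm (u j - v j))"
    by (rule lipschitz_on_boundedE[OF assms(2)])
  show "\<exists>L B. \<forall>u v. (\<forall>j\<in>I. norm (u j) \<le> R \<and> norm (v j) \<le> R) \<longrightarrow>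
      norm (f u - g u) \<le> B \<and> norm (f v - g v) \<le> B \<and>
      norm (f u - g u - (f v - g v)) \<le> L * (\<Sum>j\<in>I. norm (u j - v j))"
  proof (rule exI[of _ "L + L'"], rule exI[of _ "B + B'"], intro allI impI)
    fix u v :: "'i \<Rightarrow> 'b" assume R: "\<forall>j\<in>I. norm (u j) \<le> R \<and> norm (v j) \<le> R"
    note fR = f[THEN spec, THEN spec, THEN mp, OF R] and gR = g[THEN spec, THEN spec, THEN mp, OF R]
    have "norm (f u - g u - (f v - g v)) \<le> norm (f u - f v) + norm (g u - g v)"
      using norm_triangle_ineq4[of "f u - f v" "g u - g v"] by (simp add: algebra_simps)
    then show "norm (f u - g u) \<le> B + B' \<and> norm (f v - g v) \<le> B + B' \<and>
      norm (f u - g u - (f v - g v)) \<le> (L + L') * (\<Sum>j\<in>I. norm (u j - v j))"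
      using fR gR norm_triangle_ineq4[of "f u" "g u"] norm_triangle_ineq4[of "f v" "g v"]
      unfolding distrib_right by linarith
  qed
qed

lemma lipschitz_on_bounded_sum:
  assumes "finite J" "\<And>j. j \<in> J \<Longrightarrow> lipschitz_on_bounded I (f j)"
  shows "lipschitz_on_bounded I (\<lambda>u. \<Sum>j\<in>J. f j u)"
  using assms
proof (induction J rule: finite_induct)
  case empty
  then show ?case by (simp add: lipschitz_on_bounded_const)
next
  case (insert x J)
  \<comment> \<open>Writing a sum as a double difference reduces it to the rules for differences and
    constants.\<close>
  have "lipschitz_on_bounded I (\<lambda>u. f x u - (0 - (\<Sum>j\<in>J. f j u)))"
    using insert by (intro lipschitz_on_bounded_diff lipschitz_on_bounded_const) auto
  then show ?case using insert.hyps by simp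
qed

text \<open>The product rule for increments: p(f u, g u) - p(f v, g v) = p(f u - f v, g u) + p(f v,
  g u - g v), with the undifferenced factors bounded by \<open>B'\<close> and
  \<open>B\<close>.\<close>

lemma lipschitz_on_bounded_bilinear:
  fixes f :: "('i \<Rightarrow> 'b::real_normed_vector) \<Rightarrow> 'c::real_normed_vector"
  assumes p: "bounded_bilinear p" and "lipschitz_on_bounded I f" "lipschitz_on_bounded I g"
  shows "lipschitz_on_bounded I (\<lambda>u. p (f u) (g u))"
  unfolding lipschitz_on_bounded_def
proof
  interpret bounded_bilinear p by (rule p)
  fix R
  obtain L B where f: "\<forall>u v. (\<forall>j\<in>I. norm (u j) \<le> R \<and> norm (v j) \<le> R) \<longrightarrow>
     norm (f u) \<le> B \<and> norm (f v) \<le> B \<and> norm (f u - f v) \<le> L * (\<Sum>j\<in>I. norm (u j - v j))"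
    by (rule lipschitz_on_boundedE[OF assms(2)])
  obtain L' B' where g: "\<forall>u v. (\<forall>j\<in>I. norm (u j) \<le> R \<and> norm (v j) \<le> R) \<longrightarrow>
     norm (g u) \<le> B' \<and> norm (g v) \<le> B' \<and> norm (g u - g v) \<le> L' * (\<Sum>j\<in>I. norm (u j - v j))"
    by (rule lipschitz_on_boundedE[OF assms(3)])
  obtain K where K: "K \<ge> 0" "\<And>a b. norm (p a b) \<le> norm a * norm b * K"
    using nonneg_bounded by blast
  show "\<exists>L B. \<forall>u v. (\<forall>j\<in>I. norm (u j) \<le> R \<and> norm (v j) \<le> R) \<longrightarrow>
      norm (p (f u) (g u)) \<le> B \<and> norm (p (f v) (g v)) \<le> B \<and>
      norm (p (f u) (g u) - p (f v) (g v)) \<le> L * (\<Sum>j\<in>I. norm (u j - v j))"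
  proof (rule exI[of _ "(L * B' + B * L') * K"], rule exI[of _ "B * B' * K"], intro allI impI)
    fix u v :: "'i \<Rightarrow> 'b" assume R: "\<forall>j\<in>I. norm (u j) \<le> R \<and> norm (v j) \<le> R"
    let ?S = "\<Sum>j\<in>I. norm (u j - v j)"
    note fR = f[THEN spec, THEN spec, THEN mp, OF R] and gR = g[THEN spec, THEN spec, THEN mp, OF R]
    have B: "0 \<le> B" "0 \<le> B'" "0 \<le> L * ?S" "0 \<le> L' * ?S"
      using fR gR norm_ge_zero[of "f u"] norm_ge_zero[of "g u"] norm_ge_zero[of "f u - f v"]
        norm_ge_zero[of "g u - g v"] by linarith+
    have bound: "norm (p a b) \<le> A * A' * K" if "norm a \<le> A" "norm b \<le> A'" for a b A A'
    proof -
      have "norm a * norm b \<le> A * A'" using that by (intro mult_mono) (auto intro: order_trans[OF norm_ge_zero])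
      then have "norm a * norm b * K \<le> A * A' * K" using K(1) by (rule mult_right_mono)
      then show ?thesis using K(2)[of a b] by linarith
    qed
    have "p (f u) (g u) - p (f v) (g v) = p (f u - f v) (g u) + p (f v) (g u - g v)"
      by (simp add: diff_left diff_right)
    then have "norm (p (f u) (g u) - p (f v) (g v)) \<le> norm (p (f u - f v) (g u)) + norm (p (f v) (g u - g v))"
      by (simp add: norm_triangle_ineq)
    also have "\<dots> \<le> (L * ?S) * B' * K + B * (L' * ?S) * K"
      using fR gR by (intro add_mono bound) auto
    finally show "norm (p (f u) (g u)) \<le> B * B' * K \<and> norm (p (f v) (g v)) \<le> B * B' * K \<and>
      norm (p (f u) (g u) - p (f v) (g v)) \<le> (L * B' + B * L') * K * ?S"
      using fR gR bound[of "f u" B "g u" B'] bound[of "f v" B "g v" B'] by (simp add: algebra_simps)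
  qed
qed

section \<open>Derivatives within a half-open time interval\<close>

text \<open>Translates between the difference quotients in \<open>smooth_curve\<close> and
  derivatives of nodal values.\<close>

lemma has_vector_derivative_iff_quotient:
  "(f has_vector_derivative f') (at x within S) \<longleftrightarrow>
    ((\<lambda>y. (f y - f x) /\<^sub>R (y - x)) \<longlongrightarrow> f') (at x within S)"
proof -
  have "norm (f y - f x - (y - x) *\<^sub>R f') / norm (y - x) = norm ((f y - f x) /\<^sub>R (y - x) - f')"
    if "y \<noteq> x" for y
  proof -
    have "(f y - f x) /\<^sub>R (y - x) - f' = (f y - f x - (y - x) *\<^sub>R f') /\<^sub>R (y - x)"
      using that by (simp add: scaleR_diff_right)
    then show ?thesis by (simp add: divide_inverse mult.commute)
  qed
  then have "((\<lambda>y. norm (f y - f x - (y - x) *\<^sub>R f') / norm (y - x)) \<longlongrightarrow> 0) (at x within S) \<longleftrightarrow>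
      ((\<lambda>y. norm ((f y - f x) /\<^sub>R (y - x) - f')) \<longlongrightarrow> 0) (at x within S)"
    by (intro filterlim_cong refl) (auto simp: eventually_at_filter)
  then show ?thesis
    by (simp add: has_vector_derivative_def has_derivative_iff_norm bounded_linear_scaleR_left
        tendsto_norm_zero_iff LIM_zero_iff)
qed

text \<open>Makes one-sided derivatives unique, in particular at t = 0, so that
  \<open>time_deriv\<close> can be computed.\<close>

lemma at_within_halfopen_not_bot:
  fixes t \<tau> :: real
  assumes "t \<in> {0..<\<tau>}" shows "at t within {0..<\<tau>} \<noteq> bot"
proof -
  have "t islimpt {0..<\<tau>}"
    by (rule islimpt_subset[OF islimpt_greaterThanLessThan1[of t \<tau>]]) (use assms in auto)
  then show ?thesis using trivial_limit_within by blast
qed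

section \<open>Polynomials in the components of a curve\<close>

inductive_set polynomials_in :: "(real \<Rightarrow> real) set \<Rightarrow> (real \<Rightarrow> real) set" for X where
  gen: "f \<in> X \<Longrightarrow> f \<in> polynomials_in X"
| const: "(\<lambda>_. c) \<in> polynomials_in X"
| add: "f \<in> polynomials_in X \<Longrightarrow> g \<in> polynomials_in X \<Longrightarrow> (\<lambda>t. f t + g t) \<in> polynomials_in X"
| mult: "f \<in> polynomials_in X \<Longrightarrow> g \<in> polynomials_in X \<Longrightarrow> (\<lambda>t. f t * g t) \<in> polynomials_in X"

lemma polynomials_in_sum:
  assumes "finite I" "\<And>i. i \<in> I \<Longrightarrow> f i \<in> polynomials_in X"
  shows "(\<lambda>t. \<Sum>i\<in>I. f i t) \<in> polynomials_in X"
  using assms by (induction I rule: finite_induct) (auto intro: polynomials_in.intros)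

lemma polynomials_in_diff:
  assumes "f \<in> polynomials_in X" "g \<in> polynomials_in X"
  shows "(\<lambda>t. f t - g t) \<in> polynomials_in X"
  using polynomials_in.add[OF assms(1) polynomials_in.mult[OF polynomials_in.const[of "-1"] assms(2)]] by simp

text \<open>By the sum and product rules it suffices to differentiate generators. For the components
  of a solution of an ODE with polynomial right-hand side, the ODE itself supplies their
  derivatives.\<close>

lemma polynomials_in_derivative:
  assumes f: "f \<in> polynomials_in X"
    and X: "\<And>f. f \<in> X \<Longrightarrow> \<exists>g \<in> polynomials_in X. \<forall>t\<in>S. (f has_real_derivative g t) (at t within S)"
  shows "\<exists>g \<in> polynomials_in X. \<forall>t\<in>S. (f has_real_derivative g t) (at t within S)"
  using f
proof induction
  case (gen f) then show ?case by (rule X)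
next
  case (const c)
  show ?case by (rule bexI[OF _ polynomials_in.const[of 0]]) auto
next
  case (add f g)
  then obtain f' g' where "f' \<in> polynomials_in X" "\<forall>t\<in>S. (f has_real_derivative f' t) (at t within S)"
    "g' \<in> polynomials_in X" "\<forall>t\<in>S. (g has_real_derivative g' t) (at t within S)" by blast
  then show ?case
    by (intro bexI[of _ "\<lambda>t. f' t + g' t"]) (auto intro!: DERIV_add polynomials_in.add)
next
  case (mult f g)
  then obtain f' g' where "f' \<in> polynomials_in X" "\<forall>t\<in>S. (f has_real_derivative f' t) (at t within S)"
    "g' \<in> polynomials_in X" "\<forall>t\<in>S. (g has_real_derivative g' t) (at t within S)" by blast
  with mult show ?case
    by (intro bexI[of _ "\<lambda>t. f' t * g t + g' t * f t"])
      (auto intro!: DERIV_mult polynomials_in.add polynomials_in.mult)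
qed

text \<open>Differentiation becomes a self-map \<open>d\<close> of the polynomials, and its iterates
  are the derivatives of all orders.\<close>

lemma polynomials_in_smooth:
  assumes f: "f \<in> polynomials_in X"
    and X: "\<And>f. f \<in> X \<Longrightarrow> \<exists>g \<in> polynomials_in X. \<forall>t\<in>S. (f has_real_derivative g t) (at t within S)"
  shows "\<exists>D :: nat \<Rightarrow> real \<Rightarrow> real. D 0 = f \<and>
    (\<forall>k. \<forall>t\<in>S. (D k has_real_derivative D (Suc k) t) (at t within S))"
proof -
  obtain d where d: "\<And>f. f \<in> polynomials_in X \<Longrightarrow>
      d f \<in> polynomials_in X \<and> (\<forall>t\<in>S. (f has_real_derivative d f t) (at t within S))"
    using polynomials_in_derivative[OF _ X] by metis
  have "(d ^^ k) f \<in> polynomials_in X" for k by (induction k) (use f d in auto)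
  then show ?thesis using d by (intro exI[of _ "\<lambda>k. (d ^^ k) f"]) auto
qed

text \<open>Shows that any bilinear map is polynomial in components, so the cross product never has
  to be written out in coordinates.\<close>

lemma bilinear_component_expansion:
  fixes p :: "real^'n \<Rightarrow> real^'m \<Rightarrow> real^'k"
  assumes "bounded_bilinear p"
  shows "p x y $ k = (\<Sum>i\<in>UNIV. \<Sum>j\<in>UNIV. x $ i * (y $ j * (p (axis i 1) (axis j 1) $ k)))"
proof -
  interpret bounded_bilinear p by (rule assms)
  have "p x y = p (\<Sum>i\<in>UNIV. (x $ i) *\<^sub>R axis i 1) (\<Sum>j\<in>UNIV. (y $ j) *\<^sub>R axis j 1)"
    using basis_expansion[of x] basis_expansion[of y] by (simp add: scalar_mult_eq_scaleR)
  also have "\<dots> = (\<Sum>i\<in>UNIV. p ((x $ i) *\<^sub>R axis i 1) (\<Sum>j\<in>UNIV. (y $ j) *\<^sub>R axis j 1))"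
    by (rule sum_left)
  also have "\<dots> = (\<Sum>i\<in>UNIV. \<Sum>j\<in>UNIV. x $ i *\<^sub>R y $ j *\<^sub>R p (axis i 1) (axis j 1))"
    by (simp add: sum_right scaleR_left scaleR_right scaleR_sum_right mult.commute)
  finally show ?thesis by (simp add: mult.assoc)
qed

definition vector_polynomials_in :: "(real \<Rightarrow> real) set \<Rightarrow> (real \<Rightarrow> real^'n) set" where
  "vector_polynomials_in X = {f. \<forall>i. (\<lambda>t. f t $ i) \<in> polynomials_in X}"

lemma vector_polynomials_in_sum:
  "finite I \<Longrightarrow> (\<And>i. i \<in> I \<Longrightarrow> f i \<in> vector_polynomials_in X) \<Longrightarrow> (\<lambda>t. \<Sum>i\<in>I. f i t) \<in> vector_polynomials_in X"
  by (auto simp: vector_polynomials_in_def intro!: polynomials_in_sum)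

lemma vector_polynomials_in_diff:
  "f \<in> vector_polynomials_in X \<Longrightarrow> g \<in> vector_polynomials_in X \<Longrightarrow> (\<lambda>t. f t - g t) \<in> vector_polynomials_in X"
  by (auto simp: vector_polynomials_in_def intro!: polynomials_in_diff)

lemma vector_polynomials_in_scaleR:
  "r \<in> polynomials_in X \<Longrightarrow> f \<in> vector_polynomials_in X \<Longrightarrow> (\<lambda>t. r t *\<^sub>R f t) \<in> vector_polynomials_in X"
  by (auto simp: vector_polynomials_in_def intro!: polynomials_in.mult)

lemma vector_polynomials_in_inner:
  "f \<in> vector_polynomials_in X \<Longrightarrow> g \<in> vector_polynomials_in X \<Longrightarrow> (\<lambda>t. f t \<bullet> g t) \<in> polynomials_in X"
  by (auto simp: vector_polynomials_in_def inner_vec_def intro!: polynomials_in_sum polynomials_in.mult)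

lemma vector_polynomials_in_bilinear:
  assumes "bounded_bilinear p" "f \<in> vector_polynomials_in X" "g \<in> vector_polynomials_in X"
  shows "(\<lambda>t. p (f t) (g t)) \<in> vector_polynomials_in X"
proof -
  have "(\<lambda>t. p (f t) (g t) $ k) \<in> polynomials_in X" for k
    using assms(2,3) by (subst bilinear_component_expansion[OF assms(1)])
      (auto simp: vector_polynomials_in_def intro!: polynomials_in_sum polynomials_in.mult polynomials_in.const)
  then show ?thesis by (simp add: vector_polynomials_in_def)
qed

section \<open>Finite elements\<close>

text \<open>Gaussian elimination of one index: the Schur complement of a positive diagonal entry is
  again symmetric and positive definite.\<close>

lemma positive_definite_solvable:
  fixes M :: "'i \<Rightarrow> 'i \<Rightarrow> real"
  assumes "finite I" and sym: "\<And>a b. a \<in> I \<Longrightarrow> b \<in> I \<Longrightarrow> M a b = M b a"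
    and pos: "\<And>q. (\<exists>a\<in>I. q a \<noteq> 0) \<Longrightarrow> (\<Sum>a\<in>I. \<Sum>b\<in>I. q a * M a b * q b) > 0"
  shows "\<exists>q. \<forall>a\<in>I. (\<Sum>b\<in>I. M a b * q b) = r a"
  using assms
proof (induction I arbitrary: M r rule: finite_induct)
  case (insert i I)
  note [simp] = insert.hyps
  have m: "M i i > 0"
  proof -
    have "(\<Sum>a\<in>insert i I. \<Sum>b\<in>insert i I. (if a = i then 1 else 0) * M a b * (if b = i then 1 else 0)) > 0"
      by (rule insert.prems(2)) auto
    moreover have "(\<Sum>a\<in>I. (\<Sum>b\<in>insert i I. (if a = i then 1 else 0) * M a b * (if b = i then 1 else 0))) = 0"
      "(\<Sum>b\<in>I. (if i = i then 1 else 0) * M i b * (if b = i then 1 else 0)) = 0"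
      by (auto intro!: sum.neutral)
    ultimately show ?thesis by simp
  qed
  \<comment> \<open>The Schur complement of the entry at \<open>i\<close>.\<close>
  define M' where "M' a b = M a b - M a i * M i b / M i i" for a b
  have "\<exists>q. \<forall>a\<in>I. (\<Sum>b\<in>I. M' a b * q b) = r a - M a i * r i / M i i"
  proof (rule insert.IH)
    show "M' a b = M' b a" if "a \<in> I" "b \<in> I" for a b
      using that insert.prems(1)[of a b] insert.prems(1)[of a i] insert.prems(1)[of b i] by (simp add: M'_def)
    fix q :: "'i \<Rightarrow> real" assume q: "\<exists>a\<in>I. q a \<noteq> 0"
    define s where "s = (\<Sum>b\<in>I. M i b * q b)"
    \<comment> \<open>The value at \<open>i\<close> minimizes the quadratic form of \<open>M\<close>
      with the other entries fixed; the minimum is the form of \<open>M'\<close> at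
      \<open>q\<close>.\<close>
    define p where "p a = (if a = i then - s / M i i else q a)" for a
    have p: "p a = q a" if "a \<in> I" for a using that insert.hyps by (auto simp: p_def)
    have s': "(\<Sum>b\<in>I. q b * M b i) = s" unfolding s_def
      using insert.prems(1) by (intro sum.cong) auto
    have "\<exists>a\<in>insert i I. p a \<noteq> 0" using p q by auto
    then have "0 < (\<Sum>a\<in>insert i I. \<Sum>b\<in>insert i I. p a * M a b * p b)" by (rule insert.prems(2))
    also have "\<dots> = p i * M i i * p i + p i * s + s * p i + (\<Sum>a\<in>I. \<Sum>b\<in>I. q a * M a b * q b)"
    proof -
      have "(\<Sum>b\<in>I. p i * M i b * p b) = p i * s"
        unfolding s_def sum_distrib_left by (intro sum.cong) (auto simp: p)
      moreover have "(\<Sum>a\<in>I. p a * M a i * p i) = s * p i"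
        unfolding s'[symmetric] sum_distrib_right by (intro sum.cong) (auto simp: p)
      moreover have "(\<Sum>a\<in>I. \<Sum>b\<in>I. p a * M a b * p b) = (\<Sum>a\<in>I. \<Sum>b\<in>I. q a * M a b * q b)"
        by (intro sum.cong) (auto simp: p)
      ultimately show ?thesis by (simp add: sum.distrib)
    qed
    also have "\<dots> = (\<Sum>a\<in>I. \<Sum>b\<in>I. q a * M a b * q b) - s * s / M i i"
      using m by (simp add: p_def field_simps)
    also have "s * s = (\<Sum>a\<in>I. q a * M a i) * (\<Sum>b\<in>I. M i b * q b)"
      by (simp only: s' s_def[symmetric])
    also have "\<dots> / M i i = (\<Sum>a\<in>I. \<Sum>b\<in>I. q a * (M a i * M i b / M i i) * q b)"
      by (simp add: sum_product sum_divide_distrib mult_ac)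
    also have "(\<Sum>a\<in>I. \<Sum>b\<in>I. q a * M a b * q b) - \<dots> = (\<Sum>a\<in>I. \<Sum>b\<in>I. q a * M' a b * q b)"
      by (simp add: M'_def algebra_simps sum_subtractf)
    finally show "0 < (\<Sum>a\<in>I. \<Sum>b\<in>I. q a * M' a b * q b)" .
  qed
  then obtain q where q: "\<And>a. a \<in> I \<Longrightarrow> (\<Sum>b\<in>I. M' a b * q b) = r a - M a i * r i / M i i" by blast
  define s where "s = (\<Sum>b\<in>I. M i b * q b)"
  \<comment> \<open>Back substitution: row \<open>i\<close> of the system solved for the eliminated
    unknown.\<close>
  define p where "p a = (if a = i then (r i - s) / M i i else q a)" for a
  have p: "p a = q a" if "a \<in> I" for a using that insert.hyps by (auto simp: p_def)
  have "(\<Sum>b\<in>insert i I. M a b * p b) = r a" if "a \<in> insert i I" for a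
  proof (cases "a = i")
    case True
    have "(\<Sum>b\<in>I. M i b * p b) = s" unfolding s_def by (intro sum.cong) (auto simp: p)
    then show ?thesis using True m by (simp add: p_def)
  next
    case False
    with that have a: "a \<in> I" by simp
    have "(\<Sum>b\<in>I. M' a b * q b) = (\<Sum>b\<in>I. M a b * q b) - M a i / M i i * s"
      by (simp add: M'_def s_def algebra_simps sum_subtractf sum_distrib_left sum_divide_distrib)
    then have "(\<Sum>b\<in>I. M a b * q b) = r a - M a i * r i / M i i + M a i / M i i * s" using q[OF a] by simp
    moreover have "(\<Sum>b\<in>I. M a b * p b) = (\<Sum>b\<in>I. M a b * q b)" by (intro sum.cong) (auto simp: p)
    ultimately show ?thesis using m by (simp add: p_def field_simps)
  qed
  then show ?case by blast
qed simp

text \<open>The points where two affine functions agree form a convex set.\<close>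

lemma affine_function_eq_on_convex_hull:
  fixes b b' :: "'a::real_inner"
  assumes "\<And>a. a \<in> S \<Longrightarrow> b \<bullet> a + c = b' \<bullet> a + c'" and "x \<in> convex hull S"
  shows "b \<bullet> x + c = b' \<bullet> x + c'"
proof -
  have "convex hull S \<subseteq> {x. (b - b') \<bullet> x = c' - c}"
  proof (rule hull_minimal)
    show "S \<subseteq> {x. (b - b') \<bullet> x = c' - c}" using assms(1) by (fastforce simp: inner_diff_left)
  qed (rule convex_hyperplane)
  then show ?thesis using assms(2) by (auto simp: inner_diff_left algebra_simps)
qed

text \<open>Relative to one base point, the difference vectors are linearly independent, so a linear
  functional takes prescribed values on them.\<close>

lemma affine_interpolation:
  fixes S :: "'a::euclidean_space set"
  assumes "\<not> affine_dependent S"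
  obtains b c where "\<And>a. a \<in> S \<Longrightarrow> b \<bullet> a + c = (g a :: real)"
proof (cases "S = {}")
  case False
  then obtain s where s: "s \<in> S" by blast
  have "independent ((\<lambda>x. -s + x) ` (S - {s}))"
    using affine_dependent_iff_dependent2[OF s] assms by simp
  from linear_independent_extend[OF this, of "\<lambda>y. g (y + s) - g s"] obtain f :: "'a \<Rightarrow> real"
    where f: "linear f" "\<And>x. x \<in> S - {s} \<Longrightarrow> f (-s + x) = g x - g s" by auto
  \<comment> \<open>The Riesz representative of the functional \<open>f\<close>.\<close>
  define b where "b = adjoint f 1"
  have b: "f x = b \<bullet> x" for x
    using adjoint_works[OF f(1), of x 1] by (simp add: b_def inner_commute)
  have "b \<bullet> a + (g s - b \<bullet> s) = g a" if "a \<in> S" for a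
  proof (cases "a = s")
    case False
    then have "f (- s + a) = g a - g s" using that by (intro f(2)) simp
    then have "b \<bullet> (- s + a) = g a - g s" by (simp only: b)
    then show ?thesis by (simp only: inner_add_right inner_minus_right)
  qed simp
  then show thesis by (rule that)
qed (use that in auto)

text \<open>Measurability is assumed of \<open>g\<close> only and passes to \<open>f\<close> by
  completeness of Lebesgue measure. The intended \<open>f\<close> is a product of gradients, whose
  values on element interfaces are unspecified.\<close>

lemma integral_spike_lebesgue_on:
  fixes f g :: "'a::euclidean_space \<Rightarrow> real"
  assumes S: "S \<in> sets lebesgue" and g: "g \<in> borel_measurable (lebesgue_on S)"
    and eq: "AE x in lebesgue_on S. f x = g x"
  shows "(\<integral>x. f x \<partial>lebesgue_on S) = (\<integral>x. g x \<partial>lebesgue_on S)"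
proof -
  let ?f = "\<lambda>x. if x \<in> S then f x else 0" and ?g = "\<lambda>x. if x \<in> S then g x else 0"
  have mg: "?g \<in> borel_measurable lebesgue" using g S by (simp add: borel_measurable_if)
  have ae: "AE x in lebesgue. ?f x = ?g x"
    using eq S by (auto simp: AE_restrict_space_iff elim!: eventually_mono)
  have mf: "?f \<in> borel_measurable lebesgue"
  proof (rule measurableI)
    fix A :: "real set" assume "A \<in> sets borel"
    then have "?g -` A \<in> sets lebesgue" using measurable_sets[OF mg] by simp
    moreover have "AE x in lebesgue. x \<in> ?g -` A \<longleftrightarrow> x \<in> ?f -` A"
      using ae by eventually_elim (simp only: vimage_eq)
    ultimately have "?f -` A \<in> sets lebesgue"
      using completion.in_sets_AE[of "?g -` A" "?f -` A" lborel] by auto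
    then show "?f -` A \<inter> space lebesgue \<in> sets lebesgue" by simp
  qed simp
  have "(\<integral>x. ?f x \<partial>lebesgue) = (\<integral>x. ?g x \<partial>lebesgue)" by (rule integral_cong_AE[OF mf mg ae])
  then show ?thesis by (simp add: Lebesgue_Measure.integral_restrict_UNIV S)
qed

section \<open>Piecewise affine functions and the nodal basis\<close>

locale fe_mesh =
  fixes \<Omega> :: "(real^'n) set" and \<T> :: "(real^'n) set set"
  assumes open_domain: "open \<Omega>" and bounded_domain: "bounded \<Omega>"
    and mesh: "conforming_triangulation \<Omega> \<T>"
begin

abbreviation X where "X \<equiv> X_space \<Omega> \<T>"
abbreviation N where "N \<equiv> nodes \<T>"
abbreviation \<phi> where "\<phi> \<equiv> nodal_basis \<Omega> \<T>"
abbreviation interp where "interp \<equiv> nodal_interp \<Omega> \<T>"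

definition vertices :: "(real^'n) set \<Rightarrow> (real^'n) set" where
  "vertices K = {a. a extreme_point_of K}"

lemma finite_mesh: "finite \<T>" and mesh_union: "\<Union>\<T> = closure \<Omega>"
  and mesh_face: "K \<in> \<T> \<Longrightarrow> K' \<in> \<T> \<Longrightarrow> K \<inter> K' face_of K"
  and mesh_simplex: "K \<in> \<T> \<Longrightarrow> int CARD('n) simplex K"
  using mesh by (auto simp: conforming_triangulation_def triangulation_def)

lemma element_convex: "K \<in> \<T> \<Longrightarrow> convex K" and element_compact: "K \<in> \<T> \<Longrightarrow> compact K"
  using mesh_simplex convex_simplex compact_simplex by blast+

lemma element_vertices:
  assumes "K \<in> \<T>"
  shows "K = convex hull (vertices K)" "\<not> affine_dependent (vertices K)" "finite (vertices K)"
proof -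
  obtain C where C: "\<not> affine_dependent C" "K = convex hull C"
    using mesh_simplex[OF assms] by (auto simp: simplex_def)
  then have "vertices K = C" by (simp add: vertices_def extreme_point_of_convex_hull_affine_independent)
  with C show "K = convex hull (vertices K)" "\<not> affine_dependent (vertices K)" "finite (vertices K)"
    by (auto intro: aff_independent_finite)
qed

lemma nodes_eq: "N = (\<Union>K\<in>\<T>. vertices K)"
  by (simp add: nodes_def vertices_def)

lemma finite_nodes: "finite N"
  using finite_mesh element_vertices(3) by (auto simp: nodes_eq)

lemma vertices_subset_nodes: "K \<in> \<T> \<Longrightarrow> vertices K \<subseteq> N"
  by (auto simp: nodes_eq)

lemma nodes_in_closure: "a \<in> N \<Longrightarrow> a \<in> closure \<Omega>"
  unfolding mesh_union[symmetric] nodes_eq vertices_def extreme_point_of_def by blast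

lemma X_space_continuous: "v \<in> X \<Longrightarrow> continuous_on (closure \<Omega>) v"
  and X_space_affine: "v \<in> X \<Longrightarrow> K \<in> \<T> \<Longrightarrow> \<exists>b c. \<forall>x\<in>K. v x = b \<bullet> x + c"
  and X_space_outside: "v \<in> X \<Longrightarrow> x \<notin> closure \<Omega> \<Longrightarrow> v x = 0"
  by (auto simp: X_space_def)

text \<open>On each element both functions are affine and agree at the vertices, whose convex hull
  is the element. Off the closure both vanish by convention.\<close>

lemma X_space_eqI:
  assumes v: "v \<in> X" and w: "w \<in> X" and eq: "\<And>a. a \<in> N \<Longrightarrow> v a = w a"
  shows "v = w"
proof
  fix x show "v x = w x"
  proof (cases "x \<in> closure \<Omega>")
    case True
    then obtain K where K: "K \<in> \<T>" "x \<in> K" unfolding mesh_union[symmetric] by blast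
    obtain b c b' c' where v': "\<forall>x\<in>K. v x = b \<bullet> x + c" and w': "\<forall>x\<in>K. w x = b' \<bullet> x + c'"
      using X_space_affine[OF v K(1)] X_space_affine[OF w K(1)] by blast
    have VK: "a \<in> K" if "a \<in> vertices K" for a using that by (auto simp: vertices_def extreme_point_of_def)
    have "b \<bullet> x + c = b' \<bullet> x + c'"
    proof (rule affine_function_eq_on_convex_hull)
      show "x \<in> convex hull (vertices K)" using K element_vertices(1) by blast
      fix a assume "a \<in> vertices K"
      then show "b \<bullet> a + c = b' \<bullet> a + c'" using v' w' VK eq vertices_subset_nodes[OF K(1)] by (metis subsetD)
    qed
    then show ?thesis using v' w' K by simp
  qed (simp add: X_space_outside v w)
qed

text \<open>Affine interpolation on each element gives the pieces. By conformity two elements meet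
  in a common face; its extreme points are vertices of both elements and span it, so the pieces
  agree there and paste to a continuous function on the finite closed cover.\<close>

lemma X_space_interpolant:
  obtains v where "v \<in> X" "\<And>a. a \<in> N \<Longrightarrow> v a = g a"
proof -
  have "\<exists>b c. \<forall>a\<in>vertices K. b \<bullet> a + c = g a" if "K \<in> \<T>" for K
    using affine_interpolation[OF element_vertices(2)[OF that]] by metis
  then obtain b c where bc: "\<And>K a. K \<in> \<T> \<Longrightarrow> a \<in> vertices K \<Longrightarrow> b K \<bullet> a + c K = g a" by metis
  have consistent: "b K \<bullet> x + c K = b K' \<bullet> x + c K'" if K: "K \<in> \<T>" "K' \<in> \<T>" and x: "x \<in> K" "x \<in> K'" for K K' x
  proof (rule affine_function_eq_on_convex_hull)
    let ?F = "K \<inter> K'"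
    have F: "?F face_of K" "?F face_of K'" using mesh_face[of K K'] mesh_face[of K' K] K by (simp_all add: Int_commute)
    have "compact ?F" "convex ?F" using element_compact element_convex K by (auto intro: convex_Int compact_Int)
    then have "?F = convex hull {x. x extreme_point_of ?F}" by (rule Krein_Milman_Minkowski)
    then show "x \<in> convex hull {x. x extreme_point_of ?F}" using x by blast
    fix a assume "a \<in> {x. x extreme_point_of ?F}"
    then have "a \<in> vertices K" "a \<in> vertices K'"
      using extreme_point_of_face[OF F(1)] extreme_point_of_face[OF F(2)] by (auto simp: vertices_def)
    then show "b K \<bullet> a + c K = b K' \<bullet> a + c K'" using bc K by simp
  qed
  have "\<exists>f. continuous_on (closure \<Omega>) f \<and> (\<forall>K\<in>\<T>. \<forall>x\<in>K. f x = b K \<bullet> x + c K)"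
  proof (rule pasting_lemma_exists_closed[of \<T> "top_of_set (closure \<Omega>)" "\<lambda>K. K" euclidean "\<lambda>K x. b K \<bullet> x + c K"])
    show "closedin (top_of_set (closure \<Omega>)) K" if "K \<in> \<T>" for K
      using that element_compact mesh_union by (auto intro: closed_subset compact_imp_closed)
    show "continuous_map (subtopology (top_of_set (closure \<Omega>)) K) euclidean (\<lambda>x. b K \<bullet> x + c K)" for K
      by (simp add: subtopology_subtopology continuous_intros)
    fix f assume "continuous_map (top_of_set (closure \<Omega>)) euclidean f"
      and f: "\<And>x K. K \<in> \<T> \<Longrightarrow> x \<in> topspace (top_of_set (closure \<Omega>)) \<inter> K \<Longrightarrow> f x = b K \<bullet> x + c K"
    then show ?thesis using mesh_union by (intro exI[of _ f]) auto
  next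
    show "finite \<T>" by (rule finite_mesh)
    show "topspace (top_of_set (closure \<Omega>)) \<subseteq> \<Union> ((\<lambda>K. K) ` \<T>)" using mesh_union by simp
    show "b K \<bullet> x + c K = b K' \<bullet> x + c K'"
      if "K \<in> \<T>" "K' \<in> \<T>" "x \<in> topspace (top_of_set (closure \<Omega>)) \<inter> K \<inter> K'" for K K' x
      using that consistent by blast
  qed
  then obtain f where f: "continuous_on (closure \<Omega>) f" "\<And>K x. K \<in> \<T> \<Longrightarrow> x \<in> K \<Longrightarrow> f x = b K \<bullet> x + c K" by blast
  define v where "v x = (if x \<in> closure \<Omega> then f x else 0)" for x
  have inK: "x \<in> closure \<Omega>" if "K \<in> \<T>" "x \<in> K" for x K using that mesh_union by blast
  have "continuous_on (closure \<Omega>) v"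
    by (rule continuous_on_eq[OF f(1)]) (simp add: v_def)
  moreover have "\<exists>b c. \<forall>x\<in>K. v x = b \<bullet> x + c" if "K \<in> \<T>" for K
    using f(2)[OF that] inK[OF that] by (auto simp: v_def)
  ultimately have "v \<in> X" by (auto simp: X_space_def v_def)
  moreover have "v a = g a" if a: "a \<in> N" for a
  proof -
    obtain K where "K \<in> \<T>" "a \<in> vertices K" using a unfolding nodes_eq by blast
    moreover from this have "a \<in> K" by (auto simp: vertices_def extreme_point_of_def)
    ultimately show ?thesis using f(2) bc nodes_in_closure[OF a] by (simp add: v_def)
  qed
  ultimately show thesis by (rule that)
qed

text \<open>Unisolvence gives the \<open>THE\<close> in \<open>nodal_basis\<close> its meaning. The
  point \<open>a\<close> is arbitrary; off the nodes all prescribed values are 0 and the function is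
  zero.\<close>

lemma nodal_basis_in_X: "\<phi> a \<in> X" and nodal_basis_node: "b \<in> N \<Longrightarrow> \<phi> a b = (if b = a then 1 else 0)"
proof -
  have "\<exists>!v. v \<in> X \<and> (\<forall>b\<in>N. v b = (if b = a then 1 else 0))"
  proof (rule ex_ex1I)
    show "\<exists>v. v \<in> X \<and> (\<forall>b\<in>N. v b = (if b = a then 1 else 0))"
      by (rule X_space_interpolant[of "\<lambda>b. if b = a then 1 else 0"]) blast
  qed (auto intro: X_space_eqI)
  from theI'[OF this] show "\<phi> a \<in> X" "b \<in> N \<Longrightarrow> \<phi> a b = (if b = a then 1 else 0)"
    by (auto simp: nodal_basis_def)
qed

lemma X_space_sum:
  assumes "finite I" "\<And>i. i \<in> I \<Longrightarrow> v i \<in> X"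
  shows "(\<lambda>x. \<Sum>i\<in>I. r i * v i x) \<in> X"
proof -
  have "\<exists>b c. \<forall>x\<in>K. (\<Sum>i\<in>I. r i * v i x) = b \<bullet> x + c" if "K \<in> \<T>" for K
  proof -
    obtain b c where bc: "\<And>i x. i \<in> I \<Longrightarrow> x \<in> K \<Longrightarrow> v i x = b i \<bullet> x + c i"
      using X_space_affine[OF assms(2) \<open>K \<in> \<T>\<close>] by metis
    have "(\<Sum>i\<in>I. r i * v i x) = (\<Sum>i\<in>I. r i *\<^sub>R b i) \<bullet> x + (\<Sum>i\<in>I. r i * c i)" if "x \<in> K" for x
      using that by (simp add: bc inner_sum_left sum.distrib[symmetric] algebra_simps)
    then show ?thesis by blast
  qed
  moreover have "continuous_on (closure \<Omega>) (\<lambda>x. \<Sum>i\<in>I. r i * v i x)"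
    using X_space_continuous[OF assms(2)] by (intro continuous_intros) auto
  ultimately show ?thesis using X_space_outside[OF assms(2)] by (auto simp: X_space_def)
qed

lemma nodal_expansion_in_X: "(\<lambda>x. \<Sum>a\<in>N. r a * \<phi> a x) \<in> X"
  by (rule X_space_sum[OF finite_nodes nodal_basis_in_X])

lemma nodal_expansion_node: "b \<in> N \<Longrightarrow> (\<Sum>a\<in>N. r a * \<phi> a b) = r b"
  using finite_nodes by (simp add: nodal_basis_node if_distrib cong: if_cong)

lemma X_space_expansion:
  assumes "v \<in> X" shows "v x = (\<Sum>a\<in>N. v a * \<phi> a x)"
  by (rule fun_cong[OF X_space_eqI[OF assms nodal_expansion_in_X]]) (simp only: nodal_expansion_node)

lemma interp_in_X: "interp f \<in> X"
  using nodal_expansion_in_X[of f] by (simp add: nodal_interp_def[abs_def])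

lemma interp_node: "a \<in> N \<Longrightarrow> interp f a = f a"
  by (simp add: nodal_interp_def nodal_expansion_node)

text \<open>The nodal expansion of the constant 1, cut off outside the closure so that it belongs to
  \<open>X\<close>.\<close>

lemma nodal_basis_partition_of_unity: "x \<in> closure \<Omega> \<Longrightarrow> (\<Sum>a\<in>N. \<phi> a x) = 1"
proof -
  assume x: "x \<in> closure \<Omega>"
  let ?v = "\<lambda>x. if x \<in> closure \<Omega> then 1 else 0 :: real"
  have "?v \<in> X"
  proof -
    have "continuous_on (closure \<Omega>) ?v" by (rule continuous_on_eq[of _ "\<lambda>_. 1"]) auto
    moreover have "\<exists>b c. \<forall>x\<in>K. ?v x = b \<bullet> x + c" if "K \<in> \<T>" for K
      using that mesh_union by (intro exI[of _ 0] exI[of _ 1]) auto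
    ultimately show ?thesis by (auto simp: X_space_def)
  qed
  from X_space_expansion[OF this, of x] show ?thesis using x nodes_in_closure by simp
qed

text \<open>On an element the function is affine with vertex values 0 or 1, and a half-space
  containing the vertices contains their convex hull.\<close>

lemma nodal_basis_nonneg: "\<phi> a x \<ge> 0"
proof (cases "x \<in> closure \<Omega>")
  case True
  then obtain K where K: "K \<in> \<T>" "x \<in> K" unfolding mesh_union[symmetric] by blast
  obtain b c where bc: "\<forall>x\<in>K. \<phi> a x = b \<bullet> x + c" using X_space_affine[OF nodal_basis_in_X K(1)] by blast
  have "convex hull (vertices K) \<subseteq> {x. b \<bullet> x \<ge> - c}"
  proof (rule hull_minimal)
    show "vertices K \<subseteq> {x. b \<bullet> x \<ge> - c}"
    proof
      fix z assume z: "z \<in> vertices K"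
      then have "z \<in> K" "z \<in> N" using vertices_subset_nodes[OF K(1)] by (auto simp: vertices_def extreme_point_of_def)
      then have "b \<bullet> z + c \<ge> 0" using bc nodal_basis_node[of z a] by (metis (full_types) order_refl zero_le_one)
      then show "z \<in> {x. b \<bullet> x \<ge> - c}" by simp
    qed
  qed (rule convex_halfspace_ge)
  then show ?thesis using K bc element_vertices(1)[OF K(1)] by force
qed (simp add: X_space_outside[OF nodal_basis_in_X])

section \<open>Integration, lumped masses and the mass matrix\<close>

lemma domain_lmeasurable: "\<Omega> \<in> lmeasurable" and domain_sets: "\<Omega> \<in> sets lebesgue"
  using open_domain bounded_domain by (auto intro: lmeasurable_open fmeasurableD)

lemma integrable_continuous:
  fixes f :: "real^'n \<Rightarrow> real"
  assumes "continuous_on (closure \<Omega>) f"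
  shows "integrable (lebesgue_on \<Omega>) f"
proof -
  interpret finite_measure "lebesgue_on \<Omega>" by (rule finite_measure_lebesgue_on[OF domain_lmeasurable])
  have "compact (f ` closure \<Omega>)" using assms bounded_domain by (intro compact_continuous_image) auto
  then obtain B where "\<And>x. x \<in> closure \<Omega> \<Longrightarrow> norm (f x) \<le> B"
    using compact_imp_bounded bounded_iff by (metis imageI)
  moreover have "f \<in> borel_measurable (lebesgue_on \<Omega>)"
    using continuous_on_subset[OF assms closure_subset] domain_sets by (rule continuous_imp_measurable_on_sets_lebesgue)
  ultimately show ?thesis using closure_subset[of \<Omega>]
    by (intro integrable_const_bound[of _ B] AE_I2) auto
qed

text \<open>The function vanishes almost everywhere; its zero set is closed, hence contains the open
  set \<Omega> and then the closure. Reaching the closure matters because nodes may lie on the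
  boundary.\<close>

lemma integral_nonneg_eq_0D:
  fixes f :: "real^'n \<Rightarrow> real"
  assumes cont: "continuous_on (closure \<Omega>) f" and nonneg: "\<And>x. x \<in> \<Omega> \<Longrightarrow> f x \<ge> 0"
    and zero: "(\<integral>x. f x \<partial>lebesgue_on \<Omega>) = 0" and x: "x \<in> closure \<Omega>"
  shows "f x = 0"
proof -
  have "AE x in lebesgue_on \<Omega>. f x = 0"
    using integral_nonneg_eq_0_iff_AE[OF integrable_continuous[OF cont] AE_I2] zero nonneg by simp
  then have ae: "AE x in lebesgue. x \<in> \<Omega> \<longrightarrow> f x = 0"
    using domain_sets by (simp add: AE_restrict_space_iff)
  have cl: "closed {x \<in> closure \<Omega>. f x = 0}"
    using continuous_closed_preimage_constant[OF cont] by simp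
  have "y \<in> {x \<in> closure \<Omega>. f x = 0}" if "y \<in> \<Omega>" for y
  proof (rule mem_closed_if_AE_lebesgue_open[OF open_domain cl _ that])
    show "AE x\<in>\<Omega> in lebesgue. x \<in> {x \<in> closure \<Omega>. f x = 0}"
      using ae closure_subset[of \<Omega>] by (auto elim!: eventually_mono)
  qed
  then have "closure \<Omega> \<subseteq> {x \<in> closure \<Omega>. f x = 0}" by (intro closure_minimal cl) auto
  then show ?thesis using x by blast
qed

text \<open>These are the lumped masses m_a and, as \<open>gram\<close>, the full mass matrix
  M.\<close>

definition mass where "mass a = (\<integral>x. \<phi> a x \<partial>lebesgue_on \<Omega>)"
definition gram where "gram a b = (\<integral>x. \<phi> a x * \<phi> b x \<partial>lebesgue_on \<Omega>)"

lemma mass_pos: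
  assumes "a \<in> N" shows "mass a > 0"
proof -
  have "mass a \<ge> 0" unfolding mass_def by (intro integral_nonneg_AE) (auto simp: nodal_basis_nonneg)
  moreover have "mass a \<noteq> 0"
    using integral_nonneg_eq_0D[OF X_space_continuous[OF nodal_basis_in_X] nodal_basis_nonneg _ nodes_in_closure[OF assms], of a]
      nodal_basis_node[OF assms, of a] by (auto simp: mass_def)
  ultimately show ?thesis by simp
qed

lemma integrable_X_mult: "v \<in> X \<Longrightarrow> w \<in> X \<Longrightarrow> integrable (lebesgue_on \<Omega>) (\<lambda>x. v x * w x)"
  by (intro integrable_continuous continuous_intros X_space_continuous)

lemma L2_inner_interp:
  assumes "v \<in> X"
  shows "L2_inner \<Omega> v (interp f) = (\<Sum>a\<in>N. f a * (\<Sum>b\<in>N. gram a b * v b))"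
proof -
  have "L2_inner \<Omega> v (interp f) = (\<integral>x. (\<Sum>a\<in>N. \<Sum>b\<in>N. f a * v b * (\<phi> a x * \<phi> b x)) \<partial>lebesgue_on \<Omega>)"
    unfolding L2_inner_def
  proof (rule Bochner_Integration.integral_cong)
    fix x
    have "v x \<bullet> interp f x = (\<Sum>a\<in>N. f a * \<phi> a x) * (\<Sum>b\<in>N. v b * \<phi> b x)"
      by (simp add: nodal_interp_def X_space_expansion[OF assms, of x] mult.commute)
    then show "v x \<bullet> interp f x = (\<Sum>a\<in>N. \<Sum>b\<in>N. f a * v b * (\<phi> a x * \<phi> b x))"
      by (simp add: sum_product mult_ac)
  qed simp
  also have "\<dots> = (\<Sum>a\<in>N. \<Sum>b\<in>N. f a * v b * gram a b)"
    unfolding gram_def by (simp add: integrable_X_mult nodal_basis_in_X)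
  finally show ?thesis by (simp add: sum_distrib_left mult_ac)
qed

lemma gram_sym: "gram a b = gram b a"
  by (simp add: gram_def mult.commute)

text \<open>The quadratic form is the squared L2 norm of the finite element function with nodal
  values \<open>q\<close>; if it were zero, the function would vanish at every node.\<close>

lemma gram_positive_definite:
  assumes "\<exists>a\<in>N. q a \<noteq> 0"
  shows "(\<Sum>a\<in>N. \<Sum>b\<in>N. q a * gram a b * q b) > 0"
proof -
  let ?v = "\<lambda>x. \<Sum>a\<in>N. q a * \<phi> a x"
  have v: "?v \<in> X" by (rule nodal_expansion_in_X)
  obtain a where a: "a \<in> N" "q a \<noteq> 0" using assms by blast
  have eq: "(\<integral>x. ?v x * ?v x \<partial>lebesgue_on \<Omega>) = (\<Sum>a\<in>N. \<Sum>b\<in>N. q a * gram a b * q b)"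
  proof -
    have "(\<integral>x. ?v x * ?v x \<partial>lebesgue_on \<Omega>) = (\<integral>x. (\<Sum>a\<in>N. \<Sum>b\<in>N. q a * q b * (\<phi> a x * \<phi> b x)) \<partial>lebesgue_on \<Omega>)"
      by (simp add: sum_product mult_ac)
    also have "\<dots> = (\<Sum>a\<in>N. \<Sum>b\<in>N. q a * q b * gram a b)"
      unfolding gram_def by (simp add: integrable_X_mult nodal_basis_in_X)
    finally show ?thesis by (simp add: mult_ac)
  qed
  have "(\<integral>x. ?v x * ?v x \<partial>lebesgue_on \<Omega>) \<ge> 0" by (intro integral_nonneg_AE) auto
  moreover have "(\<integral>x. ?v x * ?v x \<partial>lebesgue_on \<Omega>) \<noteq> 0"
  proof
    assume "(\<integral>x. ?v x * ?v x \<partial>lebesgue_on \<Omega>) = 0"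
    from integral_nonneg_eq_0D[OF continuous_on_mult[OF X_space_continuous[OF v] X_space_continuous[OF v]] _ this nodes_in_closure[OF a(1)]]
    have "?v a * ?v a = 0" by simp
    then show False using a nodal_expansion_node[of a q] by simp
  qed
  ultimately show ?thesis using eq by simp
qed

lemma lumped_inner_eq: "lumped_inner \<Omega> \<T> v w = (\<Sum>a\<in>N. mass a * (v a \<bullet> w a))"
  unfolding lumped_inner_def nodal_interp_def mass_def
  by (simp add: integrable_continuous X_space_continuous nodal_basis_in_X mult.commute)

text \<open>If the nodal values are 1, the interpolant is 1 by the partition of unity. Conversely,
  testing with the interpolant of f - 1 makes its own L2 norm vanish.\<close>

lemma constraint_iff:
  "(\<forall>r\<in>X. L2_inner \<Omega> (interp f) r = L2_inner \<Omega> (\<lambda>x. 1) r) \<longleftrightarrow> (\<forall>a\<in>N. f a = 1)"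
proof
  assume "\<forall>a\<in>N. f a = 1"
  then have "interp f x = 1" if "x \<in> \<Omega>" for x
    using nodal_basis_partition_of_unity[of x] that closure_subset[of \<Omega>] by (auto simp: nodal_interp_def)
  then have "L2_inner \<Omega> (interp f) r = L2_inner \<Omega> (\<lambda>x. 1) r" for r
    unfolding L2_inner_def by (intro Bochner_Integration.integral_cong) auto
  then show "\<forall>r\<in>X. L2_inner \<Omega> (interp f) r = L2_inner \<Omega> (\<lambda>x. 1) r" by blast
next
  assume *: "\<forall>r\<in>X. L2_inner \<Omega> (interp f) r = L2_inner \<Omega> (\<lambda>x. 1) r"
  define r where "r = interp (\<lambda>a. f a - 1)"
  have r: "r \<in> X" unfolding r_def by (rule interp_in_X)
  have eq: "r x = interp f x - 1" if "x \<in> closure \<Omega>" for x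
    using nodal_basis_partition_of_unity[OF that] by (simp add: r_def nodal_interp_def algebra_simps sum_subtractf)
  have "(\<integral>x. r x * r x \<partial>lebesgue_on \<Omega>) = (\<integral>x. interp f x * r x - r x \<partial>lebesgue_on \<Omega>)"
    using closure_subset[of \<Omega>] by (intro Bochner_Integration.integral_cong) (auto simp: eq subset_iff algebra_simps)
  also have "\<dots> = L2_inner \<Omega> (interp f) r - L2_inner \<Omega> (\<lambda>x. 1) r"
    unfolding L2_inner_def using r interp_in_X
    by (subst Bochner_Integration.integral_diff)
      (auto intro: integrable_X_mult integrable_continuous X_space_continuous)
  also have "\<dots> = 0" using * r by simp
  finally have zero: "(\<integral>x. r x * r x \<partial>lebesgue_on \<Omega>) = 0" .
  have "r a * r a = 0" if "a \<in> N" for a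
    by (rule integral_nonneg_eq_0D[OF continuous_on_mult[OF X_space_continuous[OF r] X_space_continuous[OF r]]
      zero_le_square zero nodes_in_closure[OF that]])
  then show "\<forall>a\<in>N. f a = 1" by (simp add: r_def interp_node)
qed

section \<open>Element gradients and the stiffness matrix\<close>

abbreviation U where "U \<equiv> U_space \<Omega> \<T>"

definition slope :: "(real^'n) set \<Rightarrow> real^'n \<Rightarrow> real^'n" where
  "slope K a = (SOME b. \<exists>c. \<forall>x\<in>K. \<phi> a x = b \<bullet> x + c)"

text \<open>The integrand of the stiffness matrix, made total by the value 0 on element interfaces.
  Since interiors are disjoint, at most one summand survives at each point.\<close>

definition slope_product :: "real^'n \<Rightarrow> real^'n \<Rightarrow> real^'n \<Rightarrow> real" where
  "slope_product a b x = (\<Sum>K\<in>\<T>. indicat_real (interior K) x * (slope K a \<bullet> slope K b))"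

definition stiffness where "stiffness a b = (\<integral>x. slope_product a b x \<partial>lebesgue_on \<Omega>)"

lemma slope: "K \<in> \<T> \<Longrightarrow> \<exists>c. \<forall>x\<in>K. \<phi> a x = slope K a \<bullet> x + c"
  unfolding slope_def using someI_ex[OF X_space_affine[OF nodal_basis_in_X]] .

lemma nodal_basis_has_derivative:
  assumes K: "K \<in> \<T>" and x: "x \<in> interior K"
  shows "(\<phi> a has_derivative (\<lambda>h. slope K a \<bullet> h)) (at x)"
proof -
  obtain c where c: "\<forall>x\<in>K. \<phi> a x = slope K a \<bullet> x + c" using slope[OF K] by blast
  have "((\<lambda>x. slope K a \<bullet> x + c) has_derivative (\<lambda>h. slope K a \<bullet> h)) (at x)"
    by (auto intro!: derivative_eq_intros)
  then show ?thesis
    by (rule has_derivative_transform_within_open[OF _ open_interior x]) (use c interior_subset in force)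
qed

lemma U_space_expansion:
  assumes "u \<in> U" shows "u x = (\<Sum>a\<in>N. \<phi> a x *\<^sub>R u a)"
proof -
  have "u x $ i = (\<Sum>a\<in>N. u a $ i * \<phi> a x)" for i
    using X_space_expansion[of "\<lambda>x. u x $ i" x] assms by (simp add: U_space_def)
  then show ?thesis by (simp add: vec_eq_iff mult.commute)
qed

lemma grad_on_interior:
  assumes u: "u \<in> U" and K: "K \<in> \<T>" and x: "x \<in> interior K"
  shows "grad u x $ i = (\<Sum>a\<in>N. u a $ i *\<^sub>R slope K a)"
proof -
  have "((\<lambda>y. \<Sum>a\<in>N. \<phi> a y *\<^sub>R u a) has_derivative (\<lambda>h. \<Sum>a\<in>N. (slope K a \<bullet> h) *\<^sub>R u a)) (at x)"
    by (intro has_derivative_sum has_derivative_scaleR_left nodal_basis_has_derivative K x)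
  moreover have "(\<lambda>y. \<Sum>a\<in>N. \<phi> a y *\<^sub>R u a) = u"
    by (rule ext) (rule U_space_expansion[OF u, symmetric])
  ultimately have "(u has_derivative (\<lambda>h. \<Sum>a\<in>N. (slope K a \<bullet> h) *\<^sub>R u a)) (at x)" by simp
  from frechet_derivative_at[OF this]
  have "frechet_derivative u (at x) = (\<lambda>h. \<Sum>a\<in>N. (slope K a \<bullet> h) *\<^sub>R u a)" by simp
  then show ?thesis
    by (simp add: grad_def jacobian_def matrix_def vec_eq_iff inner_axis mult.commute)
qed

text \<open>The common face of \<open>K\<close> and \<open>K'\<close> contains a relative interior
  point of \<open>K\<close> and is therefore all of \<open>K\<close>; the same holds with the roles
  exchanged.\<close>

lemma interior_element_unique:
  assumes "K \<in> \<T>" "K' \<in> \<T>" "x \<in> interior K" "x \<in> interior K'"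
  shows "K = K'"
proof -
  have sub: "K \<subseteq> K'" if "K \<in> \<T>" "K' \<in> \<T>" "x \<in> interior K" "x \<in> interior K'" for K K'
  proof -
    have "x \<in> K \<inter> K' \<inter> rel_interior K"
      using that interior_subset[of K] interior_subset[of K'] interior_subset_rel_interior[of K] by blast
    then have "K \<subseteq> K \<inter> K'" using subset_of_face_of[OF mesh_face[OF that(1,2)] order_refl] by blast
    then show ?thesis by blast
  qed
  show ?thesis using sub[OF assms] sub[OF assms(2,1,4,3)] by (rule subset_antisym)
qed

lemma slope_product_on_interior:
  assumes "K \<in> \<T>" "x \<in> interior K"
  shows "slope_product a b x = slope K a \<bullet> slope K b"
proof -
  have "slope_product a b x = (\<Sum>K'\<in>\<T>. if K' = K then slope K a \<bullet> slope K b else 0)"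
    unfolding slope_product_def using assms interior_element_unique
    by (intro sum.cong) (auto simp: indicator_def)
  then show ?thesis using assms finite_mesh by simp
qed

text \<open>The frontiers of finitely many convex sets are negligible.\<close>

lemma AE_in_element_interior: "AE x in lebesgue_on \<Omega>. \<exists>K\<in>\<T>. x \<in> interior K"
proof -
  have "negligible (\<Union>K\<in>\<T>. frontier K)"
    using finite_mesh element_convex by (intro negligible_Union) (auto intro: negligible_convex_frontier)
  then have "AE x in lebesgue. x \<notin> (\<Union>K\<in>\<T>. frontier K)"
    by (intro AE_not_in) (simp add: negligible_iff_null_sets)
  then have "AE x in lebesgue. x \<in> \<Omega> \<longrightarrow> (\<exists>K\<in>\<T>. x \<in> interior K)"
  proof eventually_elim
    case (elim x)
    show ?case
    proof
      assume "x \<in> \<Omega>"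
      then obtain K where K: "K \<in> \<T>" "x \<in> K" using mesh_union closure_subset by blast
      then have "x \<in> interior K" using elim closure_subset[of K] by (auto simp: frontier_def)
      then show "\<exists>K\<in>\<T>. x \<in> interior K" using K by blast
    qed
  qed
  then show ?thesis using domain_sets by (simp add: AE_restrict_space_iff)
qed

lemma integrable_slope_product: "integrable (lebesgue_on \<Omega>) (slope_product a b)"
proof -
  interpret finite_measure "lebesgue_on \<Omega>" by (rule finite_measure_lebesgue_on[OF domain_lmeasurable])
  have "integrable (lebesgue_on \<Omega>) (indicat_real (interior K))" for K
  proof (rule integrable_const_bound[of _ 1])
    have "indicat_real (interior K) \<in> borel_measurable lebesgue" by (intro borel_measurable_indicator) auto
    then show "indicat_real (interior K) \<in> borel_measurable (lebesgue_on \<Omega>)" by (rule measurable_restrict_space1)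
  qed (auto simp: indicator_def)
  then show ?thesis unfolding slope_product_def[abs_def]
    by (intro Bochner_Integration.integrable_sum integrable_mult_left) auto
qed

text \<open>The gradients are known in element interiors only, so the integrands are compared almost
  everywhere before integrating the finite double sum.\<close>

lemma L2_inner_grad:
  assumes u: "u \<in> U" and w: "w \<in> U"
  shows "L2_inner \<Omega> (grad u) (grad w) = (\<Sum>a\<in>N. (\<Sum>b\<in>N. stiffness a b *\<^sub>R u b) \<bullet> w a)"
proof -
  let ?g = "\<lambda>x. \<Sum>a\<in>N. \<Sum>b\<in>N. (u b \<bullet> w a) * slope_product a b x"
  have int: "integrable (lebesgue_on \<Omega>) (\<lambda>x. (u b \<bullet> w a) * slope_product a b x)" for a b
    by (intro integrable_mult_right integrable_slope_product)
  have "AE x in lebesgue_on \<Omega>. grad u x \<bullet> grad w x = ?g x"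
    using AE_in_element_interior
  proof eventually_elim
    case (elim x)
    then obtain K where K: "K \<in> \<T>" "x \<in> interior K" by blast
    have "grad u x \<bullet> grad w x = (\<Sum>i\<in>UNIV. \<Sum>a\<in>N. \<Sum>b\<in>N. (u b $ i * w a $ i) * (slope K a \<bullet> slope K b))"
      unfolding inner_vec_def[of "grad u x"]
      by (simp add: grad_on_interior[OF u K] grad_on_interior[OF w K] inner_sum_left inner_sum_right
          inner_commute mult_ac)
    also have "\<dots> = (\<Sum>a\<in>N. \<Sum>i\<in>UNIV. \<Sum>b\<in>N. (u b $ i * w a $ i) * (slope K a \<bullet> slope K b))"
      by (rule sum.swap)
    also have "\<dots> = (\<Sum>a\<in>N. \<Sum>b\<in>N. \<Sum>i\<in>UNIV. (u b $ i * w a $ i) * (slope K a \<bullet> slope K b))"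
      by (intro sum.cong[OF refl] sum.swap)
    also have "\<dots> = ?g x"
      by (simp add: slope_product_on_interior[OF K] inner_vec_def[of "u _"] sum_distrib_right)
    finally show ?case .
  qed
  moreover have "?g \<in> borel_measurable (lebesgue_on \<Omega>)"
    using int by (intro borel_measurable_sum borel_measurable_integrable)
  ultimately have "L2_inner \<Omega> (grad u) (grad w) = (\<integral>x. ?g x \<partial>lebesgue_on \<Omega>)"
    unfolding L2_inner_def by (intro integral_spike_lebesgue_on[OF domain_sets])
  also have "\<dots> = (\<Sum>a\<in>N. \<Sum>b\<in>N. (u b \<bullet> w a) * stiffness a b)"
    unfolding stiffness_def by (simp add: int integrable_slope_product)
  finally show ?thesis by (simp add: inner_sum_left mult.commute)
qed

section \<open>Smooth curves of finite element functions\<close>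

lemma nodal_basis_le_1: "\<phi> a x \<le> 1"
proof (cases "a \<in> N \<and> x \<in> closure \<Omega>")
  case True
  then show ?thesis
    using member_le_sum[of a N "\<lambda>a. \<phi> a x"] nodal_basis_nonneg finite_nodes nodal_basis_partition_of_unity[of x]
    by simp
next
  case False
  have "\<phi> a x = 0" if "a \<notin> N" "x \<in> closure \<Omega>"
  proof -
    have "\<phi> a x = (\<Sum>b\<in>N. \<phi> a b * \<phi> b x)" by (rule X_space_expansion[OF nodal_basis_in_X])
    also have "\<dots> = 0" using that by (intro sum.neutral) (auto simp: nodal_basis_node)
    finally show ?thesis .
  qed
  then show ?thesis using False X_space_outside[OF nodal_basis_in_X, of x a] by (cases "x \<in> closure \<Omega>") auto
qed

text \<open>Since 0 \<le> \<phi> \<le> 1, the error of a difference quotient at any point is at most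
  the sum of the finitely many nodal errors, which makes the convergence uniform.\<close>

lemma smooth_curve_nodal_expansion:
  fixes d :: "nat \<Rightarrow> real \<Rightarrow> real^'n \<Rightarrow> 'b::real_normed_vector"
  assumes V: "\<And>k t. (\<lambda>x. \<Sum>a\<in>N. \<phi> a x *\<^sub>R d k t a) \<in> V"
    and d: "\<And>k t a. t \<in> {0..<\<tau>} \<Longrightarrow> a \<in> N \<Longrightarrow>
      ((\<lambda>s. d k s a) has_vector_derivative d (Suc k) t a) (at t within {0..<\<tau>})"
  shows "smooth_curve \<Omega> V \<tau> (\<lambda>t x. \<Sum>a\<in>N. \<phi> a x *\<^sub>R d 0 t a)"
proof -
  define D where "D k t x = (\<Sum>a\<in>N. \<phi> a x *\<^sub>R d k t a)" for k t x
  have "uniform_limit (closure \<Omega>) (\<lambda>s x. (D k s x - D k t x) /\<^sub>R (s - t)) (D (Suc k) t) (at t within {0..<\<tau>})"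
    if t: "t \<in> {0..<\<tau>}" for k t
  proof -
    define z where "z s a = (d k s a - d k t a) /\<^sub>R (s - t) - d (Suc k) t a" for s a
    have "((\<lambda>s. z s a) \<longlongrightarrow> 0) (at t within {0..<\<tau>})" if "a \<in> N" for a
      using d[OF t that, of k] unfolding z_def has_vector_derivative_iff_quotient by (rule LIM_zero)
    then have lim: "((\<lambda>s. \<Sum>a\<in>N. norm (z s a)) \<longlongrightarrow> 0) (at t within {0..<\<tau>})"
      by (intro tendsto_null_sum tendsto_norm_zero)
    have "dist ((D k s x - D k t x) /\<^sub>R (s - t)) (D (Suc k) t x) \<le> (\<Sum>a\<in>N. norm (z s a))" for s x
    proof -
      have "(D k s x - D k t x) /\<^sub>R (s - t) - D (Suc k) t x = (\<Sum>a\<in>N. \<phi> a x *\<^sub>R z s a)"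
        by (simp add: D_def z_def scaleR_diff_right sum_subtractf scaleR_sum_right mult.commute)
      also have "norm \<dots> \<le> (\<Sum>a\<in>N. norm (z s a))"
      proof (rule sum_norm_le)
        show "norm (\<phi> a x *\<^sub>R z s a) \<le> norm (z s a)" for a
          using nodal_basis_le_1[of a x] nodal_basis_nonneg[of a x] by (simp add: mult_left_le_one_le)
      qed
      finally show ?thesis by (simp add: dist_norm)
    qed
    then show ?thesis
      by (intro uniform_limitI eventually_mono[OF order_tendstoD(2)[OF lim]]) (auto intro: le_less_trans)
  qed
  moreover have "D k t \<in> V" for k t using V[of k t] by (simp add: D_def[abs_def])
  moreover have "D 0 = (\<lambda>t x. \<Sum>a\<in>N. \<phi> a x *\<^sub>R d 0 t a)" by (intro ext) (simp add: D_def)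
  ultimately show ?thesis unfolding smooth_curve_def by blast
qed

text \<open>Uniform convergence of the difference quotients implies pointwise convergence, so
  \<open>time_deriv\<close> is a genuine derivative at every point of the closure.\<close>

lemma smooth_curveD:
  assumes "smooth_curve \<Omega> V \<tau> u" and t: "t \<in> {0..<\<tau>}"
  shows "u t \<in> V"
    and "x \<in> closure \<Omega> \<Longrightarrow> ((\<lambda>s. u s x) has_vector_derivative time_deriv \<tau> u t x) (at t within {0..<\<tau>})"
proof -
  obtain D where D: "D 0 = u" "\<forall>k. \<forall>t\<in>{0..<\<tau>}. D k t \<in> V \<and>
     uniform_limit (closure \<Omega>) (\<lambda>s x. (D k s x - D k t x) /\<^sub>R (s - t)) (D (Suc k) t) (at t within {0..<\<tau>})"
    using assms(1) unfolding smooth_curve_def by (elim exE conjE)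
  from D(2)[THEN spec, THEN bspec, OF t, of 0]
  have *: "u t \<in> V" "uniform_limit (closure \<Omega>) (\<lambda>s x. (u s x - u t x) /\<^sub>R (s - t)) (D (Suc 0) t) (at t within {0..<\<tau>})"
    unfolding D(1) by (rule conjunct1, rule conjunct2)
  then show "u t \<in> V" by (rule_tac *)
  assume "x \<in> closure \<Omega>"
  from tendsto_uniform_limitI[OF *(2) this]
  have "((\<lambda>s. u s x) has_vector_derivative D (Suc 0) t x) (at t within {0..<\<tau>})"
    unfolding has_vector_derivative_iff_quotient .
  then show "((\<lambda>s. u s x) has_vector_derivative time_deriv \<tau> u t x) (at t within {0..<\<tau>})"
    unfolding time_deriv_def by (intro vector_derivative_works[THEN iffD1] differentiableI_vector)
qed

section \<open>Passing from test functions to nodal equations\<close>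

lemma U_space_nodal: "(\<lambda>x. \<Sum>a\<in>N. \<phi> a x *\<^sub>R z a) \<in> U"
proof -
  have "(\<lambda>x. (\<Sum>a\<in>N. \<phi> a x *\<^sub>R z a) $ i) \<in> X" for i
    using nodal_expansion_in_X[of "\<lambda>a. z a $ i"] by (simp add: mult.commute)
  then show ?thesis by (simp add: U_space_def)
qed

lemma nodal_expansion_vector:
  fixes z :: "real^'n \<Rightarrow> 'b::real_vector"
  assumes "b \<in> N" shows "(\<Sum>a\<in>N. \<phi> a b *\<^sub>R z a) = z b"
proof -
  have "(\<Sum>a\<in>N. \<phi> a b *\<^sub>R z a) = (\<Sum>a\<in>N. if a = b then z a else 0)"
    using assms by (intro sum.cong) (auto simp: nodal_basis_node)
  then show ?thesis using assms finite_nodes by simp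
qed

lemma U_space_eqI: "u \<in> U \<Longrightarrow> w \<in> U \<Longrightarrow> (\<And>a. a \<in> N \<Longrightarrow> u a = w a) \<Longrightarrow> u = w"
  by (rule ext) (subst (1 2) U_space_expansion; simp)

text \<open>The test function whose nodal values are \<open>E\<close> itself turns the sum into a
  sum of squares.\<close>

lemma nodal_test_iff:
  "(\<forall>w\<in>U. (\<Sum>a\<in>N. E a \<bullet> w a) = 0) \<longleftrightarrow> (\<forall>a\<in>N. E a = 0)"
proof
  assume *: "\<forall>w\<in>U. (\<Sum>a\<in>N. E a \<bullet> w a) = 0"
  have "(\<Sum>a\<in>N. E a \<bullet> E a) = (\<Sum>a\<in>N. E a \<bullet> (\<Sum>b\<in>N. \<phi> b a *\<^sub>R E b))"
    by (intro sum.cong) (simp_all add: nodal_expansion_vector)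
  also have "\<dots> = 0" using *[THEN bspec, OF U_space_nodal[of E]] .
  finally show "\<forall>a\<in>N. E a = 0" using finite_nodes by (simp add: sum_nonneg_eq_0_iff)
qed simp

lemma gram_solution_unique:
  assumes "\<And>a. a \<in> N \<Longrightarrow> (\<Sum>b\<in>N. gram a b * p b) = (\<Sum>b\<in>N. gram a b * q b)" and b: "b \<in> N"
  shows "p b = q b"
proof (rule ccontr)
  assume "p b \<noteq> q b"
  then have "(\<Sum>a\<in>N. \<Sum>b\<in>N. (p a - q a) * gram a b * (p b - q b)) > 0"
    using b by (intro gram_positive_definite) auto
  moreover have "(\<Sum>a\<in>N. \<Sum>b\<in>N. (p a - q a) * gram a b * (p b - q b)) =
      (\<Sum>a\<in>N. (p a - q a) * ((\<Sum>b\<in>N. gram a b * p b) - (\<Sum>b\<in>N. gram a b * q b)))"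
    by (simp add: sum_distrib_left sum_subtractf[symmetric] algebra_simps)
  ultimately show False using assms(1) by simp
qed

text \<open>The columns of \<open>Z\<close> solve the system for unit vectors. Choosing
  \<open>Z\<close> before \<open>r\<close> matters: with a right-hand side varying in time, the
  solution stays a linear combination with constant coefficients.\<close>

lemma gram_inverse: "\<exists>Z. \<forall>a\<in>N. \<forall>r. (\<Sum>b\<in>N. gram a b * (\<Sum>c\<in>N. Z b c * r c)) = r a"
proof -
  have "\<exists>q. \<forall>a\<in>N. (\<Sum>b\<in>N. gram a b * q b) = (if a = c then 1 else 0)" for c
    using positive_definite_solvable[OF finite_nodes, of gram "\<lambda>a. if a = c then 1 else 0"]
      gram_sym gram_positive_definite by blast
  then obtain Z where Z: "\<And>a c. a \<in> N \<Longrightarrow> (\<Sum>b\<in>N. gram a b * Z c b) = (if a = c then 1 else 0)" by metis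
  have "(\<Sum>b\<in>N. gram a b * (\<Sum>c\<in>N. Z c b * r c)) = r a" if a: "a \<in> N" for a r
  proof -
    have "(\<Sum>b\<in>N. gram a b * (\<Sum>c\<in>N. Z c b * r c)) = (\<Sum>b\<in>N. \<Sum>c\<in>N. gram a b * Z c b * r c)"
      by (simp add: sum_distrib_left mult.assoc)
    also have "\<dots> = (\<Sum>c\<in>N. \<Sum>b\<in>N. gram a b * Z c b * r c)" by (rule sum.swap)
    also have "\<dots> = (\<Sum>c\<in>N. (if a = c then 1 else 0) * r c)"
      by (simp add: sum_distrib_right[symmetric] Z[OF a])
    finally show ?thesis using a finite_nodes by (simp add: if_distrib[of "\<lambda>x. x * _"] cong: if_cong)
  qed
  then show ?thesis by (intro exI[of _ "\<lambda>b c. Z c b"]) blast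
qed

end

section \<open>The semi-discrete problem\<close>

text \<open>Treats both dimensions at once. The double product identity carries the factor \<alpha>
  because the zero map, used in two dimensions, satisfies it only in this scaled form with \<alpha>
  = 0.\<close>

locale fe_problem = fe_mesh \<Omega> \<T> for \<Omega> :: "(real^'n) set" and \<T> +
  fixes cross :: "real^'n \<Rightarrow> real^'n \<Rightarrow> real^'n" and \<gamma> \<alpha> :: real and u0h :: "real^'n \<Rightarrow> real^'n"
  assumes bilinear_cross: "bounded_bilinear cross"
    and cross_orthogonal: "x \<bullet> cross x y = 0"
    and cross_twice: "\<alpha> *\<^sub>R cross x (cross x y) = \<alpha> *\<^sub>R ((x \<bullet> y) *\<^sub>R x - (x \<bullet> x) *\<^sub>R y)"
    and gamma_pos: "\<gamma> > 0"
    and initial_in_U: "u0h \<in> U_space \<Omega> \<T>" and initial_unit: "a \<in> nodes \<T> \<Longrightarrow> norm (u0h a) = 1"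
begin

definition precession where "precession x y = \<alpha> *\<^sub>R cross x y"

definition stiff where "stiff u a = (\<Sum>b\<in>N. stiffness a b *\<^sub>R u b)"

text \<open>On the sphere this is minus the tangential part of \<open>stiff u a\<close>, scaled by
  \<gamma> over the lumped mass. The bracket is the formula for the double vector product u x (u x A
  u), which is orthogonal to u everywhere.\<close>

definition damping where
  "damping u a = (\<gamma> / mass a) *\<^sub>R ((stiff u a \<bullet> u a) *\<^sub>R u a - (u a \<bullet> u a) *\<^sub>R stiff u a)"

definition field where
  "field u a = (1 / (1 + \<alpha>\<^sup>2)) *\<^sub>R (damping u a - precession (u a) (damping u a))"

lemma bilinear_precession: "bounded_bilinear precession"
proof -
  interpret c: bounded_bilinear cross by (rule bilinear_cross)
  obtain K where K: "\<And>a b. norm (cross a b) \<le> norm a * norm b * K" using c.bounded by blast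
  show ?thesis
  proof
    have "norm (precession a b) \<le> norm a * norm b * (\<bar>\<alpha>\<bar> * K)" for a b
      using mult_left_mono[OF K[of a b], of "\<bar>\<alpha>\<bar>"] by (simp add: precession_def mult_ac)
    then show "\<exists>K. \<forall>a b. norm (precession a b) \<le> norm a * norm b * K" by blast
  qed (simp_all add: precession_def c.add_left c.add_right c.scaleR_left c.scaleR_right scaleR_add_right mult.commute)
qed

lemma precession_orthogonal: "x \<bullet> precession x y = 0"
  by (simp add: precession_def cross_orthogonal)

lemma precession_twice:
  "precession x (precession x y) = \<alpha>\<^sup>2 *\<^sub>R ((x \<bullet> y) *\<^sub>R x - (x \<bullet> x) *\<^sub>R y)"
proof -
  have "precession x (precession x y) = \<alpha> *\<^sub>R (\<alpha> *\<^sub>R cross x (cross x y))"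
    unfolding precession_def by (simp add: bounded_bilinear.scaleR_right[OF bilinear_cross])
  then show ?thesis unfolding cross_twice by (simp add: power2_eq_square)
qed

lemma one_plus_alpha_pos: "1 + \<alpha>\<^sup>2 > 0"
  by (simp add: add_pos_nonneg)

text \<open>On the plane orthogonal to a unit vector \<open>x\<close>, the map P =
  \<open>precession x\<close> satisfies P P = - \<alpha>^2, so (I + P)(I - P) is multiplication by 1
  + \<alpha>^2.\<close>

lemma gilbert_iff:
  assumes x: "x \<bullet> x = 1" and g: "x \<bullet> g = 0"
  shows "y + precession x y = g \<longleftrightarrow> y = (1 / (1 + \<alpha>\<^sup>2)) *\<^sub>R (g - precession x g)"
proof
  interpret bounded_bilinear precession by (rule bilinear_precession)
  {
    assume y: "y + precession x y = g"
    \<comment> \<open>The precession term is orthogonal to \<open>x\<close>, so \<open>y\<close>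
      inherits orthogonality from \<open>g\<close> and lies in the tangent plane.\<close>
    then have "x \<bullet> y = 0" using g precession_orthogonal[of x y] by (auto simp: inner_add_right)
    then have "precession x g = precession x y - \<alpha>\<^sup>2 *\<^sub>R y"
      using x by (simp add: y[symmetric] add_right precession_twice)
    then have "g - precession x g = (1 + \<alpha>\<^sup>2) *\<^sub>R y" using y by (simp add: algebra_simps)
    then show "y = (1 / (1 + \<alpha>\<^sup>2)) *\<^sub>R (g - precession x g)" using one_plus_alpha_pos by simp
  next
    assume y: "y = (1 / (1 + \<alpha>\<^sup>2)) *\<^sub>R (g - precession x g)"
    have "(1 + \<alpha>\<^sup>2) *\<^sub>R (y + precession x y) = (1 + \<alpha>\<^sup>2) *\<^sub>R g"
      using one_plus_alpha_pos x g
      by (simp add: y scaleR_add_right scaleR_right[symmetric] del: scaleR_right)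
        (simp add: scaleR_right diff_right precession_twice algebra_simps)
    then show "y + precession x y = g" using one_plus_alpha_pos by simp
  }
qed

lemma damping_orthogonal: "u a \<bullet> damping u a = 0"
  by (simp add: damping_def inner_diff_right inner_commute)

lemma field_orthogonal: "u a \<bullet> field u a = 0"
  by (simp add: field_def inner_diff_right precession_orthogonal damping_orthogonal)

text \<open>Taking the inner product with \<open>x\<close> eliminates the multiplier \<open>s\<close>; what remains is a
  Landau-Lifshitz-Gilbert equation, solved for the time derivative \<open>y\<close>.\<close>

lemma nodal_equation_iff:
  assumes a: "a \<in> N" and unit: "u a \<bullet> u a = 1" and orth: "u a \<bullet> y = 0"
  shows "mass a *\<^sub>R (y + precession (u a) y) + \<gamma> *\<^sub>R (stiff u a + s *\<^sub>R u a) = 0 \<longleftrightarrow>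
    s = - (stiff u a \<bullet> u a) \<and> y = field u a"
proof -
  have m: "mass a > 0" by (rule mass_pos[OF a])
  have "y + precession (u a) y = damping u a \<longleftrightarrow> y = field u a"
    unfolding field_def by (rule gilbert_iff[OF unit damping_orthogonal[of u a]])
  moreover have "s = - (stiff u a \<bullet> u a)"
    if eq: "mass a *\<^sub>R (y + precession (u a) y) + \<gamma> *\<^sub>R (stiff u a + s *\<^sub>R u a) = 0"
  proof -
    have "u a \<bullet> (mass a *\<^sub>R (y + precession (u a) y) + \<gamma> *\<^sub>R (stiff u a + s *\<^sub>R u a)) = 0" by (simp add: eq)
    then have "\<gamma> * (stiff u a \<bullet> u a + s) = 0"
      using unit orth by (simp add: inner_add_right precession_orthogonal inner_commute)
    then show ?thesis using gamma_pos by simp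
  qed
  moreover have "mass a *\<^sub>R (y + precession (u a) y) + \<gamma> *\<^sub>R (stiff u a + s *\<^sub>R u a) = 0 \<longleftrightarrow>
      y + precession (u a) y = damping u a" if s: "s = - (stiff u a \<bullet> u a)"
  proof -
    have "\<gamma> *\<^sub>R (stiff u a + s *\<^sub>R u a) = - mass a *\<^sub>R damping u a"
      using m unit by (simp add: damping_def s algebra_simps)
    then have "mass a *\<^sub>R (y + precession (u a) y) + \<gamma> *\<^sub>R (stiff u a + s *\<^sub>R u a) =
        mass a *\<^sub>R (y + precession (u a) y - damping u a)"
      by (simp add: algebra_simps)
    then show ?thesis using m by simp
  qed
  ultimately show ?thesis by blast
qed

text \<open>The function \<open>p\<close> stands for the time derivative. It may be arbitrary
  because the lumped product sees nodal values only, so \<open>time_deriv\<close> can be inserted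
  without showing that it lies in \<open>U\<close>.\<close>

lemma semidiscrete_equations_iff:
  assumes u: "u \<in> U" and q: "q \<in> X"
  shows "(\<forall>w\<in>U. \<forall>r\<in>X.
        lumped_inner \<Omega> \<T> p w + \<gamma> * L2_inner \<Omega> (grad u) (grad w)
        + \<gamma> * L2_inner \<Omega> q (interp (\<lambda>x. u x \<bullet> w x))
        + \<alpha> * lumped_inner \<Omega> \<T> (\<lambda>x. cross (u x) (p x)) w = 0 \<and>
        L2_inner \<Omega> (interp (\<lambda>x. u x \<bullet> u x)) r = L2_inner \<Omega> (\<lambda>x. 1) r) \<longleftrightarrow>
    (\<forall>a\<in>N. mass a *\<^sub>R (p a + precession (u a) (p a)) +
       \<gamma> *\<^sub>R (stiff u a + (\<Sum>b\<in>N. gram a b * q b) *\<^sub>R u a) = 0) \<and> (\<forall>a\<in>N. u a \<bullet> u a = 1)"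
    (is "(\<forall>w\<in>U. \<forall>r\<in>X. ?A w = 0 \<and> ?B r) \<longleftrightarrow> (\<forall>a\<in>N. ?E a = 0) \<and> ?C")
proof -
  have "?A w = (\<Sum>a\<in>N. ?E a \<bullet> w a)" if "w \<in> U" for w
  proof -
    have "?A w = (\<Sum>a\<in>N. mass a * (p a \<bullet> w a) + \<gamma> * (stiff u a \<bullet> w a)
        + \<gamma> * ((u a \<bullet> w a) * (\<Sum>b\<in>N. gram a b * q b)) + \<alpha> * (mass a * (cross (u a) (p a) \<bullet> w a)))"
      by (simp add: lumped_inner_eq L2_inner_grad[OF u that] L2_inner_interp[OF q] stiff_def
          sum.distrib sum_distrib_left)
    also have "\<dots> = (\<Sum>a\<in>N. ?E a \<bullet> w a)"
      by (intro sum.cong refl) (simp add: precession_def algebra_simps)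
    finally show ?thesis .
  qed
  then have "(\<forall>w\<in>U. ?A w = 0) \<longleftrightarrow> (\<forall>a\<in>N. ?E a = 0)" using nodal_test_iff[of ?E] by simp
  moreover have "(\<forall>r\<in>X. ?B r) \<longleftrightarrow> ?C" by (rule constraint_iff)
  \<comment> \<open>Lets the joint quantification over \<open>w\<close> and \<open>r\<close> split
    into two independent statements.\<close>
  moreover have "X \<noteq> {}" "U \<noteq> {}" using u q by auto
  ultimately show ?thesis by blast
qed

abbreviation solution where
  "solution \<equiv> semidiscrete_solution cross \<Omega> \<T> \<gamma> \<alpha> u0h"

text \<open>Every solution obeys the nodal ODE: the constraint makes |u_a|^2 constant in time, and
  its vanishing derivative is the orthogonality needed to solve for multiplier and time
  derivative.\<close>

lemma solution_nodal:
  assumes sol: "solution \<tau> u q" and t: "t \<in> {0..<\<tau>}" and a: "a \<in> N"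
  shows "u t a \<bullet> u t a = 1" "(\<Sum>b\<in>N. gram a b * q t b) = - (stiff (u t) a \<bullet> u t a)"
    "((\<lambda>s. u s a) has_vector_derivative field (u t) a) (at t within {0..<\<tau>})"
proof -
  have su: "smooth_curve \<Omega> U \<tau> u" and sq: "smooth_curve \<Omega> X \<tau> q"
    using sol by (auto simp: semidiscrete_solution_def)
  have eqs: "(\<forall>a\<in>N. mass a *\<^sub>R (time_deriv \<tau> u s a + precession (u s a) (time_deriv \<tau> u s a)) +
       \<gamma> *\<^sub>R (stiff (u s) a + (\<Sum>b\<in>N. gram a b * q s b) *\<^sub>R u s a) = 0) \<and> (\<forall>a\<in>N. u s a \<bullet> u s a = 1)"
    if s: "s \<in> {0..<\<tau>}" for s
    using sol s unfolding semidiscrete_equations_iff[OF smooth_curveD(1)[OF su s] smooth_curveD(1)[OF sq s], symmetric]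
      semidiscrete_solution_def by blast
  have unit: "u s a \<bullet> u s a = 1" if "s \<in> {0..<\<tau>}" for s using eqs[OF that] a by blast
  then show "u t a \<bullet> u t a = 1" using t .
  have du: "((\<lambda>s. u s a) has_vector_derivative time_deriv \<tau> u t a) (at t within {0..<\<tau>})"
    by (rule smooth_curveD(2)[OF su t nodes_in_closure[OF a]])
  have "((\<lambda>s. u s a \<bullet> u s a) has_vector_derivative u t a \<bullet> time_deriv \<tau> u t a + time_deriv \<tau> u t a \<bullet> u t a)
      (at t within {0..<\<tau>})"
    by (rule bounded_bilinear.has_vector_derivative[OF bounded_bilinear_inner du du])
  moreover have "((\<lambda>s. u s a \<bullet> u s a) has_vector_derivative 0) (at t within {0..<\<tau>})"
    by (rule has_vector_derivative_transform[OF t _ has_vector_derivative_const[of 1]]) (simp add: unit)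
  ultimately have "u t a \<bullet> time_deriv \<tau> u t a + time_deriv \<tau> u t a \<bullet> u t a = 0"
    by (intro vector_derivative_unique_within[OF at_within_halfopen_not_bot[OF t]])
  then have "u t a \<bullet> time_deriv \<tau> u t a = 0" by (simp add: inner_commute)
  then have "(\<Sum>b\<in>N. gram a b * q t b) = - (stiff (u t) a \<bullet> u t a) \<and> time_deriv \<tau> u t a = field (u t) a"
    using eqs[OF t] a nodal_equation_iff[where u="u t", OF a unit[OF t]] by blast
  then show "(\<Sum>b\<in>N. gram a b * q t b) = - (stiff (u t) a \<bullet> u t a)"
    "((\<lambda>s. u s a) has_vector_derivative field (u t) a) (at t within {0..<\<tau>})" using du by auto
qed

section \<open>Uniqueness for the semi-discrete problem\<close>

lemma lipschitz_field:
  assumes a: "a \<in> N" shows "lipschitz_on_bounded N (\<lambda>u. field u a)"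
proof -
  note proj = lipschitz_on_bounded_proj[OF finite_nodes]
  note scale = lipschitz_on_bounded_bilinear[OF bounded_bilinear_scaleR]
  have stiff: "lipschitz_on_bounded N (\<lambda>u. stiff u a)"
    unfolding stiff_def by (intro lipschitz_on_bounded_sum finite_nodes scale lipschitz_on_bounded_const proj)
  have "lipschitz_on_bounded N (\<lambda>u. damping u a)"
    unfolding damping_def
    by (intro scale lipschitz_on_bounded_const lipschitz_on_bounded_diff stiff proj a
        lipschitz_on_bounded_bilinear[OF bounded_bilinear_inner])
  then show ?thesis unfolding field_def
    by (intro scale lipschitz_on_bounded_const lipschitz_on_bounded_diff proj a
        lipschitz_on_bounded_bilinear[OF bilinear_precession])
qed

lemma lipschitz_field_uniform:
  obtains L where "\<forall>a\<in>N. \<forall>u v. (\<forall>j\<in>N. norm (u j) \<le> R \<and> norm (v j) \<le> R) \<longrightarrow>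
    norm (field u a - field v a) \<le> L * (\<Sum>j\<in>N. norm (u j - v j))"
proof -
  have "\<exists>L. \<forall>u v. (\<forall>j\<in>N. norm (u j) \<le> R \<and> norm (v j) \<le> R) \<longrightarrow>
    norm (field u a - field v a) \<le> L * (\<Sum>j\<in>N. norm (u j - v j))" if "a \<in> N" for a
    by (rule lipschitz_on_boundedE[OF lipschitz_field[OF that], of R]) blast
  then have "\<forall>a\<in>N. \<exists>L. \<forall>u v. (\<forall>j\<in>N. norm (u j) \<le> R \<and> norm (v j) \<le> R) \<longrightarrow>
    norm (field u a - field v a) \<le> L * (\<Sum>j\<in>N. norm (u j - v j))" by (rule ballI)
  from bchoice[OF this] obtain L where L: "\<forall>a\<in>N. \<forall>u v. (\<forall>j\<in>N. norm (u j) \<le> R \<and> norm (v j) \<le> R) \<longrightarrow>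
    norm (field u a - field v a) \<le> L a * (\<Sum>j\<in>N. norm (u j - v j))" by (elim exE)
  show thesis
  proof (rule that, intro ballI allI impI)
    fix a and u v :: "real^'n \<Rightarrow> real^'n" assume a: "a \<in> N" and R: "\<forall>j\<in>N. norm (u j) \<le> R \<and> norm (v j) \<le> R"
    have "norm (field u a - field v a) \<le> L a * (\<Sum>j\<in>N. norm (u j - v j))"
      using L[THEN bspec, OF a, THEN spec, THEN spec, THEN mp, OF R] .
    also have "\<dots> \<le> (\<Sum>b\<in>N. \<bar>L b\<bar>) * (\<Sum>j\<in>N. norm (u j - v j))"
      using member_le_sum[of a N "\<lambda>b. \<bar>L b\<bar>"] a finite_nodes by (intro mult_right_mono sum_nonneg) auto
    finally show "norm (field u a - field v a) \<le> (\<Sum>b\<in>N. \<bar>L b\<bar>) * (\<Sum>j\<in>N. norm (u j - v j))" .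
  qed
qed

text \<open>Nodal values of both solutions have norm 1, so the Lipschitz constant for radius 1
  serves at all times in the Gronwall argument. Equal \<open>u\<close> gives equal right-hand sides
  for the multiplier, and positive definiteness of the mass matrix gives equal
  \<open>q\<close>.\<close>

lemma solution_unique:
  assumes sol: "solution \<tau> u q" and sol': "solution \<tau> u' q'" and t: "t \<in> {0..<\<tau>}"
  shows "u' t = u t" "q' t = q t"
proof -
  obtain L where L: "\<forall>a\<in>N. \<forall>u v. (\<forall>j\<in>N. norm (u j) \<le> 1 \<and> norm (v j) \<le> 1) \<longrightarrow>
    norm (field u a - field v a) \<le> L * (\<Sum>j\<in>N. norm (u j - v j))"
    by (rule lipschitz_field_uniform[where R=1])
  have nodal: "u' t a = u t a" if "a \<in> N" for a
  proof (rule gronwall_unique_system[OF finite_nodes, of \<tau> field u' u L])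
    show "norm (field (u' s) b - field (u s) b) \<le> L * (\<Sum>j\<in>N. norm (u' s j - u s j))"
      if "s \<in> {0..<\<tau>}" "b \<in> N" for s b
      using solution_nodal(1)[OF sol that(1)] solution_nodal(1)[OF sol' that(1)]
      by (intro L[THEN bspec, THEN spec, THEN spec, THEN mp] that) (simp add: norm_eq_sqrt_inner)
    show "u' 0 b = u 0 b" for b using sol sol' by (simp add: semidiscrete_solution_def)
  qed (use solution_nodal(3)[OF sol] solution_nodal(3)[OF sol'] t that in auto)
  have U: "u t \<in> U" "u' t \<in> U" and X: "q t \<in> X" "q' t \<in> X"
    using sol sol' smooth_curveD(1)[OF _ t] by (auto simp: semidiscrete_solution_def)
  show eq: "u' t = u t" by (rule U_space_eqI[OF U(2,1) nodal])
  have "q' t a = q t a" if "a \<in> N" for a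
  proof (rule gram_solution_unique[OF _ that])
    show "(\<Sum>b\<in>N. gram a b * q' t b) = (\<Sum>b\<in>N. gram a b * q t b)" if "a \<in> N" for a
      using solution_nodal(2)[OF sol t that] solution_nodal(2)[OF sol' t that] eq by simp
  qed
  then show "q' t = q t" by (rule X_space_eqI[OF X(2,1)])
qed

section \<open>Existence and smoothness in time\<close>

text \<open>The ODE flow and the finite element function built from it are only known to agree at
  nodes; this and the next lemma transfer the nodal quantities between them.\<close>

lemma stiff_cong: "(\<And>b. b \<in> N \<Longrightarrow> u b = v b) \<Longrightarrow> stiff u a = stiff v a"
  unfolding stiff_def by (intro sum.cong) auto

lemma field_cong:
  assumes "\<And>b. b \<in> N \<Longrightarrow> u b = v b" and "a \<in> N"
  shows "field u a = field v a"
proof -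
  have "stiff u a = stiff v a" by (rule stiff_cong[OF assms(1)])
  moreover have "u a = v a" by (rule assms)+
  ultimately show ?thesis by (simp only: field_def damping_def)
qed

lemma stiff_vector_polynomial:
  assumes "\<And>a. a \<in> N \<Longrightarrow> (\<lambda>t. y t a) \<in> vector_polynomials_in G"
  shows "(\<lambda>t. stiff (y t) a) \<in> vector_polynomials_in G"
  unfolding stiff_def using assms
  by (intro vector_polynomials_in_sum finite_nodes vector_polynomials_in_scaleR polynomials_in.const)

lemma field_vector_polynomial:
  assumes y: "\<And>a. a \<in> N \<Longrightarrow> (\<lambda>t. y t a) \<in> vector_polynomials_in G" and a: "a \<in> N"
  shows "(\<lambda>t. field (y t) a) \<in> vector_polynomials_in G"
proof -
  note stiff = stiff_vector_polynomial[OF y]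
  have damping: "(\<lambda>t. damping (y t) a) \<in> vector_polynomials_in G"
    unfolding damping_def
    by (intro vector_polynomials_in_scaleR vector_polynomials_in_diff vector_polynomials_in_inner
        polynomials_in.const stiff y a)
  show ?thesis
    unfolding field_def
    by (intro vector_polynomials_in_scaleR vector_polynomials_in_diff polynomials_in.const
        vector_polynomials_in_bilinear[OF bilinear_precession] damping y a)
qed

text \<open>\<open>field_orthogonal\<close> holds for all families, on or off the sphere, so |y_a|^2
  has zero derivative along the flow and keeps its initial value 1.\<close>

lemma flow_exists:
  obtains \<tau> y where "\<tau> > 0" "\<And>a. a \<in> N \<Longrightarrow> y 0 a = u0h a"
    "\<And>t a. t \<in> {0..<\<tau>} \<Longrightarrow> a \<in> N \<Longrightarrow>
      ((\<lambda>s. y s a) has_vector_derivative field (y t) a) (at t within {0..<\<tau>})"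
    "\<And>t a. t \<in> {0..<\<tau>} \<Longrightarrow> a \<in> N \<Longrightarrow> y t a \<bullet> y t a = 1"
proof (rule picard_lindelof_system[OF finite_nodes, of field u0h])
  show "\<exists>L. \<forall>u v. (\<forall>j\<in>N. norm (u j) \<le> R \<and> norm (v j) \<le> R) \<longrightarrow>
       norm (field u a - field v a) \<le> L * (\<Sum>j\<in>N. norm (u j - v j))" if "a \<in> N" for R a
    by (rule lipschitz_field_uniform[where R=R]) (use that in blast)
  fix \<tau> y assume \<tau>: "\<tau> > 0" and y0: "\<And>a. a \<in> N \<Longrightarrow> y 0 a = u0h a"
    and dy: "\<And>t a. t \<in> {0..\<tau>} \<Longrightarrow> a \<in> N \<Longrightarrow>
      ((\<lambda>s. y s a) has_vector_derivative field (y t) a) (at t within {0..\<tau>})"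
  show thesis
  proof (rule that[of \<tau> y, OF \<tau> y0])
    show "((\<lambda>s. y s a) has_vector_derivative field (y t) a) (at t within {0..<\<tau>})"
      if "t \<in> {0..<\<tau>}" "a \<in> N" for t a
      by (rule has_vector_derivative_within_subset[OF dy]) (use that in auto)
    fix t a assume t: "t \<in> {0..<\<tau>}" and a: "a \<in> N"
    have "((\<lambda>s. y s a \<bullet> y s a) has_vector_derivative 0) (at s within {0..\<tau>})" if "s \<in> {0..\<tau>}" for s
      using bounded_bilinear.has_vector_derivative[OF bounded_bilinear_inner dy[OF that a] dy[OF that a]]
      by (simp add: inner_commute[of "field _ _"] field_orthogonal)
    then obtain c where c: "\<And>s. s \<in> {0..\<tau>} \<Longrightarrow> y s a \<bullet> y s a = c"
      using has_vector_derivative_zero_constant[OF convex_real_interval(5)] by blast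
    have "y t a \<bullet> y t a = c" by (rule c) (use t in auto)
    also have "\<dots> = y 0 a \<bullet> y 0 a" by (rule c[symmetric]) (use \<tau> in auto)
    also have "\<dots> = 1" using initial_unit[OF a] by (simp add: y0[OF a] norm_eq_1)
    finally show "y t a \<bullet> y t a = 1" .
  qed
qed

text \<open>The flow prescribes the nodal values of \<open>u\<close>, the inverse mass matrix those
  of \<open>q\<close>. Both are polynomials in the flow components, which provides their derivatives
  of every order.\<close>

lemma solution_exists:
  obtains \<tau> u q where "\<tau> > 0" "solution \<tau> u q"
proof (rule flow_exists)
  fix \<tau> y assume \<tau>: "\<tau> > 0" and y0: "\<And>a. a \<in> N \<Longrightarrow> y 0 a = u0h a"
    and dy: "\<And>t a. t \<in> {0..<\<tau>} \<Longrightarrow> a \<in> N \<Longrightarrow>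
      ((\<lambda>s. y s a) has_vector_derivative field (y t) a) (at t within {0..<\<tau>})"
    and unit: "\<And>t a. t \<in> {0..<\<tau>} \<Longrightarrow> a \<in> N \<Longrightarrow> y t a \<bullet> y t a = 1"
  \<comment> \<open>The generators are the scalar components of the flow; the ODE puts their
    derivatives back among the polynomials in \<open>G\<close>.\<close>
  define G where "G = {(\<lambda>t. y t a $ i) | a i. a \<in> N}"
  have yG: "(\<lambda>t. y t a) \<in> vector_polynomials_in G" if "a \<in> N" for a
    using that by (auto simp: vector_polynomials_in_def G_def intro!: polynomials_in.gen)
  have G: "\<exists>g\<in>polynomials_in G. \<forall>t\<in>{0..<\<tau>}. (f has_real_derivative g t) (at t within {0..<\<tau>})"
    if f_in: "f \<in> G" for f
  proof -
    obtain a i where a: "a \<in> N" and f: "f = (\<lambda>t. y t a $ i)" using f_in by (auto simp: G_def)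
    have "(\<lambda>t. field (y t) a $ i) \<in> polynomials_in G"
      using field_vector_polynomial[OF yG a] by (simp add: vector_polynomials_in_def)
    then show ?thesis
    proof (rule bexI[rotated], intro ballI)
      show "(f has_real_derivative field (y t) a $ i) (at t within {0..<\<tau>})" if "t \<in> {0..<\<tau>}" for t
        using bounded_linear.has_vector_derivative[OF bounded_linear_vec_nth dy[OF that a], of i]
        by (simp add: f has_real_derivative_iff_has_vector_derivative)
    qed
  qed
  define jet where "jet f D \<longleftrightarrow> D 0 = f \<and>
      (\<forall>k. \<forall>t\<in>{0..<\<tau>}. (D k has_real_derivative D (Suc k) t) (at t within {0..<\<tau>}))"
    for f and D :: "nat \<Rightarrow> real \<Rightarrow> real"
  \<comment> \<open>One derivative sequence is fixed for each function \<open>f\<close>, to be used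
    for every component of u and every coefficient of q.\<close>
  define D where "D f = (SOME D. jet f D)" for f
  have D: "jet f (D f)" if f: "f \<in> polynomials_in G" for f
  proof -
    have "\<exists>d. jet f d"
      unfolding jet_def
    proof (rule polynomials_in_smooth[OF f])
      show "\<exists>g\<in>polynomials_in G. \<forall>t\<in>{0..<\<tau>}. (f has_real_derivative g t) (at t within {0..<\<tau>})"
        if "f \<in> G" for f using that by (rule G)
    qed
    then show ?thesis unfolding D_def by (rule someI_ex)
  qed
  have D0: "D f 0 = f" if "f \<in> polynomials_in G" for f
    using D[OF that] unfolding jet_def by (rule conjunct1)
  have dD: "((\<lambda>s. D f k s) has_real_derivative D f (Suc k) t) (at t within {0..<\<tau>})"
    if "f \<in> polynomials_in G" "t \<in> {0..<\<tau>}" for f k t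
    using D[OF that(1), unfolded jet_def, THEN conjunct2, THEN spec, THEN bspec, OF that(2)] .
  obtain Z where Z: "\<forall>a\<in>N. \<forall>r. (\<Sum>b\<in>N. gram a b * (\<Sum>c\<in>N. Z b c * r c)) = r a"
    using gram_inverse by (elim exE)
  \<comment> \<open>The nodal values of the multiplier, solving M q = - (A u) . u. The sign is
    written as a factor -1 so that the closure rules for products and constants apply.\<close>
  define p where "p b t = (\<Sum>c\<in>N. Z b c * (- 1 * (stiff (y t) c \<bullet> y t c)))" for b t
  have pG: "p b \<in> polynomials_in G" for b
    unfolding p_def[abs_def]
    by (intro polynomials_in_sum finite_nodes polynomials_in.mult polynomials_in.const
        vector_polynomials_in_inner stiff_vector_polynomial yG)
  have yiG: "(\<lambda>t. y t a $ i) \<in> polynomials_in G" if "a \<in> N" for a i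
    using yG[OF that] by (simp add: vector_polynomials_in_def)
  \<comment> \<open>The k-th time derivative at node \<open>a\<close>; order 0 gives back
    \<open>y\<close>, which makes \<open>u\<close> the expansion of the flow.\<close>
  define du where "du k t a = (\<chi> i. D (\<lambda>t. y t a $ i) k t)" for k t a
  define dq where "dq k t a = D (p a) k t" for k t a
  define u where "u t x = (\<Sum>a\<in>N. \<phi> a x *\<^sub>R du 0 t a)" for t x
  define q where "q t x = (\<Sum>a\<in>N. \<phi> a x *\<^sub>R dq 0 t a)" for t x
  have su: "smooth_curve \<Omega> U \<tau> u"
    unfolding u_def[abs_def]
  proof (rule smooth_curve_nodal_expansion)
    fix k t a assume t: "t \<in> {0..<\<tau>}" and a: "a \<in> N"
    have "((\<lambda>s. \<Sum>i\<in>UNIV. D (\<lambda>t. y t a $ i) k s *\<^sub>R axis i 1) has_vector_derivative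
        (\<Sum>i\<in>UNIV. D (\<lambda>t. y t a $ i) (Suc k) t *\<^sub>R axis i (1::real))) (at t within {0..<\<tau>})"
      by (intro has_vector_derivative_sum bounded_linear.has_vector_derivative[OF bounded_linear_scaleR_left]
          dD[OF yiG[OF a] t, unfolded has_real_derivative_iff_has_vector_derivative])
    moreover have "(\<Sum>i\<in>UNIV. c i *\<^sub>R axis i (1::real)) = (\<chi> i. c i)" for c :: "'n \<Rightarrow> real"
      using basis_expansion[of "\<chi> i. c i"] by (simp add: scalar_mult_eq_scaleR)
    ultimately show "((\<lambda>s. du k s a) has_vector_derivative du (Suc k) t a) (at t within {0..<\<tau>})"
      by (simp add: du_def)
  qed (rule U_space_nodal)
  have sq: "smooth_curve \<Omega> X \<tau> q"
    unfolding q_def[abs_def]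
  proof (rule smooth_curve_nodal_expansion)
    show "((\<lambda>s. dq k s a) has_vector_derivative dq (Suc k) t a) (at t within {0..<\<tau>})"
      if "t \<in> {0..<\<tau>}" for k t a
      using dD[OF pG that] by (simp add: dq_def has_real_derivative_iff_has_vector_derivative[symmetric])
    show "(\<lambda>x. \<Sum>a\<in>N. \<phi> a x *\<^sub>R dq k t a) \<in> X" for k t
      using nodal_expansion_in_X[of "dq k t"] by (simp add: mult.commute)
  qed
  have u: "u t a = y t a" if "a \<in> N" for t a
    unfolding u_def nodal_expansion_vector[OF that] du_def D0[OF yiG[OF that]] by (simp add: vec_eq_iff)
  have q: "q t a = p a t" if "a \<in> N" for t a
    unfolding q_def nodal_expansion_vector[OF that] dq_def D0[OF pG] ..
  have "u 0 = u0h"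
    using \<tau> by (intro U_space_eqI smooth_curveD(1)[OF su] initial_in_U) (auto simp: u y0)
  moreover have "\<forall>w\<in>U. \<forall>r\<in>X.
        lumped_inner \<Omega> \<T> (time_deriv \<tau> u t) w + \<gamma> * L2_inner \<Omega> (grad (u t)) (grad w)
        + \<gamma> * L2_inner \<Omega> (q t) (interp (\<lambda>x. u t x \<bullet> w x))
        + \<alpha> * lumped_inner \<Omega> \<T> (\<lambda>x. cross (u t x) (time_deriv \<tau> u t x)) w = 0 \<and>
        L2_inner \<Omega> (interp (\<lambda>x. u t x \<bullet> u t x)) r = L2_inner \<Omega> (\<lambda>x. 1) r"
    if t: "t \<in> {0..<\<tau>}" for t
    unfolding semidiscrete_equations_iff[OF smooth_curveD(1)[OF su t] smooth_curveD(1)[OF sq t]]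
  proof (intro conjI ballI)
    fix a assume a: "a \<in> N"
    show unit': "u t a \<bullet> u t a = 1" using unit[OF t a] by (simp add: u[OF a])
    have fu: "field (u t) a = field (y t) a" by (rule field_cong[OF u a])
    have "((\<lambda>s. u s a) has_vector_derivative field (y t) a) (at t within {0..<\<tau>})"
      using dy[OF t a] by (simp add: u[OF a])
    then have td: "time_deriv \<tau> u t a = field (u t) a"
      unfolding fu time_deriv_def by (rule vector_derivative_within[OF at_within_halfopen_not_bot[OF t]])
    have "(\<Sum>b\<in>N. gram a b * q t b) = (\<Sum>b\<in>N. gram a b * p b t)"
      by (intro sum.cong) (simp_all add: q)
    also have "\<dots> = - (stiff (y t) a \<bullet> y t a)"
      unfolding p_def by (subst Z[THEN bspec, OF a, THEN spec]) simp
    also have "\<dots> = - (stiff (u t) a \<bullet> u t a)"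
      by (simp add: u[OF a] stiff_cong[of "u t" "y t", OF u])
    finally have multiplier: "(\<Sum>b\<in>N. gram a b * q t b) = - (stiff (u t) a \<bullet> u t a)" .
    have "u t a \<bullet> time_deriv \<tau> u t a = 0" unfolding td by (rule field_orthogonal)
    from iffD2[OF nodal_equation_iff[where u="u t", OF a unit' this] conjI[OF multiplier td]]
    show "mass a *\<^sub>R (time_deriv \<tau> u t a + precession (u t a) (time_deriv \<tau> u t a)) +
       \<gamma> *\<^sub>R (stiff (u t) a + (\<Sum>b\<in>N. gram a b * q t b) *\<^sub>R u t a) = 0" .
  qed
  ultimately have "solution \<tau> u q" using su sq unfolding semidiscrete_solution_def by blast
  with \<tau> show thesis by (rule that)
qed

lemma solution_exists_unique:
  "\<exists>\<tau>>0. \<exists>u q. solution \<tau> u q \<and>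
     (\<forall>u' q'. solution \<tau> u' q' \<longrightarrow> (\<forall>t\<in>{0..<\<tau>}. u' t = u t \<and> q' t = q t))"
proof (rule solution_exists)
  fix \<tau> u q assume "\<tau> > 0" and sol: "solution \<tau> u q"
  moreover have "u' t = u t \<and> q' t = q t" if "solution \<tau> u' q'" "t \<in> {0..<\<tau>}" for u' q' t
    using solution_unique[OF sol that] by (rule conjI)
  ultimately show ?thesis by blast
qed

end

theorem lemma4p2:
  fixes \<gamma> \<alpha> :: real
  assumes "\<gamma> > 0" and "\<alpha> \<ge> 0"
  shows
    "(\<forall>(\<Omega> :: (real^2) set) H \<T> h u0 u0h.
        polyhedral_lipschitz_domain \<Omega> \<and> mesh_family \<Omega> H \<T> \<and> shape_regular H \<T> \<and> quasi_uniform H \<T> \<and>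
        h \<in> H \<and> admissible_data \<Omega> (\<T> h) u0 u0h \<longrightarrow>
        (\<exists>T\<^sub>h>0. \<exists>u q. semidiscrete_solution (\<lambda>_ _. 0) \<Omega> (\<T> h) \<gamma> 0 u0h T\<^sub>h u q \<and>
           (\<forall>u' q'. semidiscrete_solution (\<lambda>_ _. 0) \<Omega> (\<T> h) \<gamma> 0 u0h T\<^sub>h u' q' \<longrightarrow>
              (\<forall>t\<in>{0..<T\<^sub>h}. u' t = u t \<and> q' t = q t)))) \<and>
     (\<forall>(\<Omega> :: (real^3) set) H \<T> h u0 u0h.
        polyhedral_lipschitz_domain \<Omega> \<and> mesh_family \<Omega> H \<T> \<and> shape_regular H \<T> \<and> quasi_uniform H \<T> \<and>
        h \<in> H \<and> admissible_data \<Omega> (\<T> h) u0 u0h \<longrightarrow>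
        (\<exists>T\<^sub>h>0. \<exists>u q. semidiscrete_solution cross3 \<Omega> (\<T> h) \<gamma> \<alpha> u0h T\<^sub>h u q \<and>
           (\<forall>u' q'. semidiscrete_solution cross3 \<Omega> (\<T> h) \<gamma> \<alpha> u0h T\<^sub>h u' q' \<longrightarrow>
              (\<forall>t\<in>{0..<T\<^sub>h}. u' t = u t \<and> q' t = q t))))"
proof (intro conjI allI impI; elim conjE)
  fix \<Omega> :: "(real^2) set" and H \<T> h u0 u0h
  assume "polyhedral_lipschitz_domain \<Omega>" "mesh_family \<Omega> H \<T>" "h \<in> H" "admissible_data \<Omega> (\<T> h) u0 u0h"
  moreover have "bounded_bilinear (\<lambda>(x::real^2) (y::real^2). 0 :: real^2)"
    by (rule bounded_bilinear.intro) (auto intro!: exI[of _ 0])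
  \<comment> \<open>For the zero map, \<open>cross_twice\<close> holds because \<alpha> is
    instantiated by 0.\<close>
  ultimately interpret fe_problem \<Omega> "\<T> h" "\<lambda>_ _. 0" \<gamma> 0 u0h
    using assms(1)
    by (intro fe_problem.intro fe_mesh.intro fe_problem_axioms.intro)
      (simp_all add: polyhedral_lipschitz_domain_def mesh_family_def admissible_data_def)
  show "\<exists>T\<^sub>h>0. \<exists>u q. solution T\<^sub>h u q \<and>
      (\<forall>u' q'. solution T\<^sub>h u' q' \<longrightarrow> (\<forall>t\<in>{0..<T\<^sub>h}. u' t = u t \<and> q' t = q t))"
    by (rule solution_exists_unique)
next
  fix \<Omega> :: "(real^3) set" and H \<T> h u0 u0h
  assume *: "polyhedral_lipschitz_domain \<Omega>" "mesh_family \<Omega> H \<T>" "h \<in> H" "admissible_data \<Omega> (\<T> h) u0 u0h"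
  \<comment> \<open>Outside the locale, \<open>bilinear_cross\<close> is the fact about
    \<open>cross3\<close>; in finite dimension bilinearity already implies boundedness. Below,
    \<open>Lagrange\<close> supplies the double product identity.\<close>
  have "bounded_bilinear cross3"
    using bilinear_conv_bounded_bilinear bilinear_cross by blast
  with * interpret fe_problem \<Omega> "\<T> h" cross3 \<gamma> \<alpha> u0h
    using assms
    by (intro fe_problem.intro fe_mesh.intro fe_problem_axioms.intro)
      (simp_all add: polyhedral_lipschitz_domain_def mesh_family_def admissible_data_def dot_cross_self Lagrange)
  show "\<exists>T\<^sub>h>0. \<exists>u q. solution T\<^sub>h u q \<and>
      (\<forall>u' q'. solution T\<^sub>h u' q' \<longrightarrow> (\<forall>t\<in>{0..<T\<^sub>h}. u' t = u t \<and> q' t = q t))"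
    by (rule solution_exists_unique)
qed

end
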